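(* Let $a>0$, $b>0$ and $\nu>-\tfrac12$ be real numbers with $a\le b<2\pi$. Then the following (convergent) asymptotic expansion holds for $a\to 0$: $$\sum_{n=1}^\infty \frac{e^{-an}}{(\frac12 bn)^\nu}\,J_\nu(bn)=\frac{\sqrt{\pi}}{b\,\Gamma(\nu+\frac12)}\left(1+\frac{a^2}{b^2}\right)^{\nu-\frac12}-\frac{1}{2\Gamma(1+\nu)}-\frac{2a}{b^2\,\Gamma(\nu)}\,{}_2F_1\left(1,1-\nu;\frac32;-\frac{a^2}{b^2}\right)+\frac{1}{\pi}\sum_{k=0}^\infty(-1)^k C_k\left(\frac{a}{2\pi}\right)^{2k+1},$$ where, for $k=0,1,2,\ldots$, $$C_k=\sum_{n=0}^\infty A_{k,n}\left(\frac{b}{2\pi}\right)^{2n},\qquad A_{k,n}=\frac{\Gamma(k+n+1)\,\Gamma(k+n+\frac32)}{k!\,n!\,\Gamma(k+\frac32)\,\Gamma(n+1+\nu)}\,\zeta(2k+2n+2).$$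
   Context: $J_\nu$ is the Bessel function of the first kind of order $\nu$, ${}_2F_1$ is the Gauss hypergeometric function, $\Gamma$ is the gamma function (with $1/\Gamma(\nu)=0$ when $\nu=0$), and $\zeta$ is the Riemann zeta function.
   Formalization: The series over k diverges when a+b>2π (e.g. a=b=5), so a≤b<2π does not suffice; convergence is asserted for a+b<2π, equality for every a≤b at which the series over k converges, plus the error O(a^(2N+1)) after N terms as a→0+. *)

theory Defs
  imports "HOL-Analysis.Analysis" "HOL-Library.Landau_Symbols"
begin

(* Bessel function of the first kind of real order. Since powr needs a positive base, this is
   J_nu(x) for x > 0 only. *)
definition Bessel_J :: "real \<Rightarrow> real \<Rightarrow> real" where
  "Bessel_J \<nu> x =
     (x / 2) powr \<nu> * (\<Sum>m. (-1) ^ m * rGamma (real m + \<nu> + 1) / fact m * (x / 2) ^ (2 * m))"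

(* Gauss series of 2F1. At points z of the unit circle where it converges, its value is that of the
   continuation of 2F1 from inside the disc. For a = 1, b = 1 - nu, c = 3/2 and nu > -1/2 it
   converges on -1 <= z <= 0 (at z = -1 because c - a - b = nu - 1/2 > -1). *)
definition hypergeo_2F1 :: "real \<Rightarrow> real \<Rightarrow> real \<Rightarrow> real \<Rightarrow> real" where
  "hypergeo_2F1 a b c z = eval_fps (fps_hypergeo [a, b] [c] 1) z"

(* Dirichlet series of the Riemann zeta function, meaningful for s > 1. *)
definition Riemann_zeta :: "real \<Rightarrow> real" where
  "Riemann_zeta s = (\<Sum>n. 1 / real (Suc n) powr s)"

definition coeff_A :: "real \<Rightarrow> nat \<Rightarrow> nat \<Rightarrow> real" where
  "coeff_A \<nu> k n =
     Gamma (real k + real n + 1) * Gamma (real k + real n + 3 / 2) /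
       (fact k * fact n * Gamma (real k + 3 / 2) * Gamma (real n + 1 + \<nu>)) *
     Riemann_zeta (2 * real k + 2 * real n + 2)"

definition coeff_C :: "real \<Rightarrow> real \<Rightarrow> nat \<Rightarrow> real" where
  "coeff_C b \<nu> k = (\<Sum>n. coeff_A \<nu> k n * (b / (2 * pi)) ^ (2 * n))"

end

theory Submission
  imports Defs
begin

text \<open>
  Up to normalisation \<open>J\<^sub>\<nu>(x) / (x/2)\<^sup>\<nu>\<close> is the integral of \<open>cos (x * sqrt u)\<close> against the Beta density
  \<open>u powr (- 1 / 2) * (1 - u) powr (\<nu> - 1 / 2)\<close> on the unit interval, so the sum over \<open>n\<close> becomes the
  integral of the real part of \<open>1 / (exp w - 1)\<close> with \<open>w = a + i b sqrt u\<close>. For \<open>\<bar>w\<bar> < 2 * pi\<close> the partial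
  fractions of the cotangent give
  \<open>1 / (exp w - 1) = 1 / w - 1 / 2 + 1 / pi * (\<Sum>k. (-1)^k * \<zeta>(2 k + 2) * (w / (2 * pi))^(2 k + 1))\<close>.
  The odd powers of \<open>w\<close>, expanded binomially and integrated, form the diagonal sums of the double series
  \<open>A\<^sub>k\<^sub>,\<^sub>n\<close>, where \<open>A\<^sub>k\<^sub>,\<^sub>n\<close> is a binomial coefficient times a moment of the density times a zeta value; this
  series converges absolutely for \<open>a + b < 2 * pi\<close>. The integral of \<open>Re (1 / w)\<close> solves a first-order linear
  differential equation in \<open>a / b\<close> whose solution is the combination of the power and \<open>\<^sub>2F\<^sub>1\<close>. If the series
  over \<open>k\<close> converges at all, then \<open>a + b \<le> 2 * pi\<close>, and the boundary case is Abel's limit theorem.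
\<close>

section \<open>Double series and Abel summation\<close>

text \<open>The variable u is the square of the usual Poisson variable, so only integer moments
  occur. The weight is unbounded at u = 0 and, for \<nu> < 1/2, at u = 1; pointwise bounds are
  therefore asked only for 0 < u < 1 and transferred by finiteness of the measure.

  The delicate point of the pole term is s = a / b = 1: for \<nu> \<le> 1/2 the Gauss series
  converges there only conditionally. Its partial sums, however, solve the same differential
  equation up to one defect term, proportional to the first omitted coefficient. Comparing the two
  solutions gives convergence and value together, uniformly up to s = 1. The free constant of the
  equation is fixed by the limit s -> 0+, where the kernel becomes singular; an integration by parts
  against an arctangent provides that limit.

  At a + b = 2 pi absolute convergence of the double series may fail, so all rearrangements are
  confined to a + b < 2 pi, and the boundary is reached by scaling a with a factor r < 1.\<close>

lemma abs_summable_double_series: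
  fixes f :: "nat \<Rightarrow> nat \<Rightarrow> 'a :: banach"
  assumes "\<And>i. summable (\<lambda>j. norm (f i j))"
    and "summable (\<lambda>i. \<Sum>j. norm (f i j))"
  shows "(\<lambda>(i, j). norm (f i j)) summable_on UNIV"
proof -
  have "(\<lambda>(i, j). norm (f i j)) summable_on (SIGMA i:UNIV. UNIV)"
  proof (rule summable_on_SigmaI)
    show "((\<lambda>j. case (i, j) of (i, j) \<Rightarrow> norm (f i j)) has_sum (\<Sum>j. norm (f i j))) UNIV" for i
      using assms(1) by (auto intro!: sums_nonneg_imp_has_sum summable_sums)
    show "(\<lambda>i. \<Sum>j. norm (f i j)) summable_on UNIV"
      using assms by (intro summable_nonneg_imp_summable_on suminf_nonneg) auto
  qed auto
  then show ?thesis by simp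
qed

lemma double_series_rows:
  fixes f :: "nat \<Rightarrow> nat \<Rightarrow> 'a :: banach"
  assumes "(\<lambda>(i, j). norm (f i j)) summable_on UNIV"
  shows "summable (f i)"
    and "(\<lambda>i. \<Sum>j. f i j) sums (\<Sum>\<^sub>\<infinity>(i, j)\<in>UNIV. f i j)"
proof -
  have s: "(\<lambda>(i, j). f i j) summable_on (SIGMA i:UNIV. UNIV)"
    by (rule abs_summable_summable) (use assms in \<open>simp add: case_prod_unfold\<close>)
  have row: "f i summable_on UNIV" for i
  proof (rule abs_summable_summable)
    show "(\<lambda>j. norm (f i j)) summable_on UNIV"
      using assms Infinite_Sum.abs_summable_on_Sigma_iff[where f = "\<lambda>(i, j). f i j" and A = UNIV and B = "\<lambda>_. UNIV"]
      by (simp add: case_prod_unfold)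
  qed
  then show "summable (f i)" by (rule summable_on_imp_summable)
  have "((\<lambda>i. \<Sum>j. f i j) has_sum (\<Sum>\<^sub>\<infinity>(i, j)\<in>(SIGMA i:UNIV. UNIV). f i j)) UNIV"
  proof (rule has_sum_SigmaD[OF has_sum_infsum[OF s]])
    fix i
    have "(f i has_sum infsum (f i) UNIV) UNIV" using row by simp
    moreover from this have "infsum (f i) UNIV = suminf (f i)"
      using has_sum_imp_sums sums_unique by blast
    ultimately show "((\<lambda>y. case (i, y) of (i, j) \<Rightarrow> f i j) has_sum (\<Sum>j. f i j)) UNIV" by simp
  qed
  then show "(\<lambda>i. \<Sum>j. f i j) sums (\<Sum>\<^sub>\<infinity>(i, j)\<in>UNIV. f i j)"
    by (auto dest: has_sum_imp_sums)
qed

lemma abs_summable_double_swap: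
  fixes f :: "nat \<Rightarrow> nat \<Rightarrow> 'a :: banach"
  assumes "(\<lambda>(i, j). norm (f i j)) summable_on UNIV"
  shows "(\<lambda>(j, i). norm (f i j)) summable_on UNIV"
  using assms summable_on_swap[of "\<lambda>(i, j). norm (f i j)" UNIV UNIV] by simp

lemma double_series_columns:
  fixes f :: "nat \<Rightarrow> nat \<Rightarrow> 'a :: banach"
  assumes "(\<lambda>(i, j). norm (f i j)) summable_on UNIV"
  shows "(\<lambda>j. \<Sum>i. f i j) sums (\<Sum>i. \<Sum>j. f i j)"
proof -
  have "(\<Sum>\<^sub>\<infinity>(j, i)\<in>UNIV. f i j) = (\<Sum>\<^sub>\<infinity>(i, j)\<in>UNIV. f i j)"
    by (rule infsum_reindex_bij_betw[where g = prod.swap, symmetric, THEN trans])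
       (auto simp: case_prod_unfold bij_swap)
  then show ?thesis
    using double_series_rows(2)[OF assms] double_series_rows(2)[OF abs_summable_double_swap[OF assms]]
    by (simp add: sums_iff)
qed

lemma bij_betw_diagonal:
  "bij_betw (\<lambda>(N, n). (N - n, n)) (SIGMA N:UNIV. {..N}) (UNIV :: (nat \<times> nat) set)"
  by (rule bij_betwI[of _ _ _ "\<lambda>(k, n). (k + n, n)"]) auto

text \<open>The antidiagonal N collects what belongs to the power 2 N + 1 of w; summing over
  antidiagonals or over rows is regrouping one unconditional sum.\<close>

lemma double_series_diagonal:
  fixes f :: "nat \<Rightarrow> nat \<Rightarrow> 'a :: banach"
  assumes "(\<lambda>(i, j). norm (f i j)) summable_on UNIV"
  shows "(\<lambda>N. \<Sum>n\<le>N. f (N - n) n) sums (\<Sum>i. \<Sum>j. f i j)"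
proof -
  define S where "S = (\<Sum>\<^sub>\<infinity>(i, j)\<in>UNIV. f i j)"
  have "(\<lambda>(i, j). f i j) summable_on UNIV"
    by (rule abs_summable_summable) (use assms in \<open>simp add: case_prod_unfold\<close>)
  then have "((\<lambda>(i, j). f i j) has_sum S) UNIV"
    unfolding S_def by (rule has_sum_infsum)
  then have "((\<lambda>p. (\<lambda>(i, j). f i j) ((\<lambda>(N, n). (N - n, n)) p)) has_sum S) (SIGMA N:UNIV. {..N})"
    using has_sum_reindex_bij_betw[OF bij_betw_diagonal, of "\<lambda>(i, j). f i j"] by simp
  then have "((\<lambda>N. \<Sum>n\<le>N. f (N - n) n) has_sum S) UNIV"
    by (rule has_sum_SigmaD) (auto intro: has_sum_finiteI)
  then show ?thesis
    using double_series_rows(2)[OF assms] by (auto dest: has_sum_imp_sums simp: S_def sums_iff)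
qed

text \<open>For nonnegative terms any grouping decides summability. Antidiagonals are the grouping
  in which the binomial theorem gives bounds.\<close>

lemma abs_summable_diagonal:
  fixes f :: "nat \<Rightarrow> nat \<Rightarrow> 'a :: banach"
  assumes "summable (\<lambda>N. \<Sum>n\<le>N. norm (f (N - n) n))"
  shows "(\<lambda>(i, j). norm (f i j)) summable_on UNIV"
proof -
  have "(\<lambda>(N, n). norm (f (N - n) n)) summable_on (SIGMA N:UNIV. {..N})"
  proof (rule summable_on_SigmaI)
    show "(\<lambda>N. \<Sum>n\<le>N. norm (f (N - n) n)) summable_on UNIV"
      using assms by (intro summable_nonneg_imp_summable_on sum_nonneg) auto
  qed (auto intro: has_sum_finiteI)
  then show ?thesis
    using summable_on_reindex_bij_betw[OF bij_betw_diagonal, of "\<lambda>(i, j). norm (f i j)"]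
    by (simp add: case_prod_unfold)
qed

text \<open>Summation by parts: the power series minus its limit is (1 - r) times the power series
  of the defects \<open>d\<close> of the partial sums, and these tend to 0.\<close>

lemma Abel_limit:
  fixes c :: "nat \<Rightarrow> real"
  assumes "summable c"
  shows "((\<lambda>r. \<Sum>k. c k * r ^ k) \<longlongrightarrow> suminf c) (at_left 1)"
proof -
  \<comment> \<open>The partial sum includes index n, so consecutive differences of \<open>d\<close>
    give \<open>c\<close>, except that \<open>suminf c\<close> is left over at n = 0.\<close>
  define d where "d n = (\<Sum>k<Suc n. c k) - suminf c" for n
  have d0: "d \<longlonglongrightarrow> 0"
    using LIMSEQ_Suc[OF summable_LIMSEQ[OF assms]] unfolding d_def by (auto intro: LIM_zero)
  then obtain B where B: "\<And>n. \<bar>d n\<bar> \<le> B"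
    using convergent_imp_Bseq[of d] by (auto simp: convergent_def Bseq_def)
  have sd: "summable (\<lambda>n. \<bar>d n\<bar> * r ^ n)" if "0 < r" "r < 1" for r :: real
    by (rule summable_comparison_test'[of "\<lambda>n. B * r ^ n"])
       (use that B in \<open>auto simp: abs_mult intro!: mult_right_mono summable_mult summable_geometric\<close>)
  have sd': "summable (\<lambda>n. d n * r ^ n)" if "0 < r" "r < 1" for r :: real
    by (rule summable_rabs_cancel) (use sd[OF that] that in \<open>simp add: abs_mult\<close>)
  have key: "(\<Sum>k. c k * r ^ k) - suminf c = (1 - r) * (\<Sum>n. d n * r ^ n)"
    if r: "0 < r" "r < 1" for r :: real
  proof -
    have "(\<lambda>n. d n * r ^ n - r * (case n of 0 \<Rightarrow> 0 | Suc m \<Rightarrow> d m * r ^ m)) sums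
            ((\<Sum>n. d n * r ^ n) - r * (\<Sum>n. d n * r ^ n))"
    proof (intro sums_diff sums_mult summable_sums sd'[OF r])
      show "(\<lambda>n. case n of 0 \<Rightarrow> 0 | Suc m \<Rightarrow> d m * r ^ m) sums (\<Sum>n. d n * r ^ n)"
        by (subst sums_Suc_iff[symmetric, where f = "\<lambda>n. case n of 0 \<Rightarrow> 0 | Suc m \<Rightarrow> d m * r ^ m", simplified])
           (use sd'[OF r] in \<open>simp add: summable_sums\<close>)
    qed
    also have "(\<lambda>n. d n * r ^ n - r * (case n of 0 \<Rightarrow> 0 | Suc m \<Rightarrow> d m * r ^ m)) =
        (\<lambda>n. c n * r ^ n - (if n = 0 then suminf c else 0))"
      by (auto simp: fun_eq_iff d_def algebra_simps split: nat.splits)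
    finally have "(\<lambda>n. c n * r ^ n - (if n = 0 then suminf c else 0) + (if n = 0 then suminf c else 0))
        sums ((\<Sum>n. d n * r ^ n) - r * (\<Sum>n. d n * r ^ n) + suminf c)"
      by (rule sums_add) (rule sums_single)
    then show ?thesis by (simp add: sums_iff algebra_simps)
  qed
  have "((\<lambda>r. (1 - r) * (\<Sum>n. d n * r ^ n)) \<longlongrightarrow> 0) (at_left 1)"
  proof (rule tendstoI)
    fix e :: real assume "e > 0"
    then obtain N where N: "\<And>n. n \<ge> N \<Longrightarrow> \<bar>d n\<bar> < e / 2"
      using d0 unfolding LIMSEQ_def by (metis dist_real_def diff_zero half_gt_zero)
    define K where "K = (\<Sum>n<N. \<bar>d n\<bar>)"
    \<comment> \<open>Indices below N contribute at most K, damped by 1 - r; beyond N every defect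
      is below e / 2, and the factor 1 - r cancels the geometric sum.\<close>
    have bound: "\<bar>(1 - r) * (\<Sum>n. d n * r ^ n)\<bar> \<le> (1 - r) * K + e / 2" if r: "0 < r" "r < 1" for r
    proof -
      have "\<bar>\<Sum>n. d n * r ^ n\<bar> \<le> (\<Sum>n. \<bar>d n\<bar> * r ^ n)"
        using summable_rabs[of "\<lambda>n. d n * r ^ n"] sd[OF r] r by (simp add: abs_mult)
      also have "\<dots> \<le> (\<Sum>n. (if n < N then \<bar>d n\<bar> else 0) + e / 2 * r ^ n)"
      proof (rule suminf_le[OF _ sd[OF r]])
        show "\<bar>d n\<bar> * r ^ n \<le> (if n < N then \<bar>d n\<bar> else 0) + e / 2 * r ^ n" for n
        proof (cases "n < N")
          case True
          have "\<bar>d n\<bar> * r ^ n \<le> \<bar>d n\<bar> * 1"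
            using r by (intro mult_left_mono power_le_one) auto
          moreover have "e / 2 * r ^ n \<ge> 0" using \<open>e > 0\<close> r by simp
          ultimately show ?thesis using True by auto
        next
          case False
          have "\<bar>d n\<bar> * r ^ n \<le> e / 2 * r ^ n"
            by (rule mult_right_mono) (use N[of n] False r in auto)
          then show ?thesis using False by simp
        qed
        show "summable (\<lambda>n. (if n < N then \<bar>d n\<bar> else 0) + e / 2 * r ^ n)"
          using r by (intro summable_add summable_mult summable_geometric summable_If_finite) auto
      qed
      also have "(\<lambda>n. (if n < N then \<bar>d n\<bar> else 0) + e / 2 * r ^ n) sums (K + e / 2 * (1 / (1 - r)))"
        unfolding K_def using sums_If_finite[of "\<lambda>n. n < N" "\<lambda>n. \<bar>d n\<bar>"] r
        by (intro sums_add sums_mult geometric_sums) (auto simp: lessThan_def)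
      then have "(\<Sum>n. (if n < N then \<bar>d n\<bar> else 0) + e / 2 * r ^ n) = K + e / 2 * (1 / (1 - r))"
        by (simp add: sums_iff)
      finally have "(1 - r) * \<bar>\<Sum>n. d n * r ^ n\<bar> \<le> (1 - r) * (K + e / 2 * (1 / (1 - r)))"
        using r by (intro mult_left_mono) auto
      also have "\<dots> = (1 - r) * K + e / 2" using r by (simp add: field_simps)
      finally show ?thesis using r by (simp add: abs_mult)
    qed
    have "((\<lambda>r. (1 - r) * K + e / 2) \<longlongrightarrow> (1 - 1) * K + e / 2) (at_left 1)"
      by (intro tendsto_intros)
    then have "\<forall>\<^sub>F r in at_left 1. (1 - r) * K + e / 2 < e"
      by (rule order_tendstoD) (use \<open>e > 0\<close> in auto)
    moreover have "\<forall>\<^sub>F r in at_left 1. r \<in> {0<..<1::real}"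
      by (rule eventually_at_left_real) simp
    ultimately show "\<forall>\<^sub>F r in at_left 1. dist ((1 - r) * (\<Sum>n. d n * r ^ n)) 0 < e"
      by eventually_elim (use bound in fastforce)
  qed
  then have "((\<lambda>r. (1 - r) * (\<Sum>n. d n * r ^ n) + suminf c) \<longlongrightarrow> 0 + suminf c) (at_left 1)"
    by (intro tendsto_intros)
  moreover have "\<forall>\<^sub>F r in at_left 1. (1 - r) * (\<Sum>n. d n * r ^ n) + suminf c = (\<Sum>k. c k * r ^ k)"
    using eventually_at_left_real[of 0 "1::real", OF zero_less_one]
    by (rule eventually_mono) (simp add: key[symmetric])
  ultimately show ?thesis
    by (auto elim: Lim_transform_eventually)
qed

section \<open>The expansion of the geometric series of exponentials\<close>

text \<open>The logarithmic derivative of the reflection formula expresses pi cot (pi z) by two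
  values of Digamma, whose defining series combine to the partial fractions.\<close>

lemma cot_partial_fractions:
  fixes z :: complex
  assumes z: "0 < norm z" "norm z < 1"
  shows "(\<lambda>n. 2 * z / (of_nat (Suc n) ^ 2 - z ^ 2)) sums (1 / z - of_real pi * cot (of_real pi * z))"
proof -
  have notint: "z \<notin> \<int>"
  proof
    assume "z \<in> \<int>"
    then obtain k where k: "z = of_int k" by (auto elim: Ints_cases)
    then show False using z by simp
  qed
  have np: "z \<notin> \<int>\<^sub>\<le>\<^sub>0" "1 - z \<notin> \<int>\<^sub>\<le>\<^sub>0"
    using notint nonpos_Ints_subset_Ints Ints_diff[of 1 "1 - z"] by auto
  have s0: "sin (of_real pi * w) \<noteq> 0" if "w \<notin> \<int>" for w :: complex
  proof
    assume "sin (of_real pi * w) = 0"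
    then obtain n :: int where "of_real pi * w = of_real (of_int n * pi)"
      by (auto simp: Complex_Transcendental.sin_eq_0)
    then have "w = of_int n" by simp
    then show False using that by simp
  qed
  have G0: "Gamma z \<noteq> 0" "Gamma (1 - z) \<noteq> 0"
    using np by (simp_all add: Gamma_eq_zero_iff)
  have "((\<lambda>w. Gamma w * Gamma (1 - w) * sin (of_real pi * w)) has_field_derivative
      (Gamma z * Digamma z * Gamma (1 - z) - Gamma z * (Gamma (1 - z) * Digamma (1 - z))) * sin (of_real pi * z)
      + Gamma z * Gamma (1 - z) * (of_real pi * cos (of_real pi * z))) (at z)"
    using np by (auto intro!: derivative_eq_intros simp: algebra_simps)
  \<comment> \<open>By reflection the product is the constant pi on the open set of
    non-integers.\<close>
  moreover have "((\<lambda>w. Gamma w * Gamma (1 - w) * sin (of_real pi * w)) has_field_derivative 0) (at z)"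
  proof (rule has_field_derivative_transform_within_open)
    show "((\<lambda>w. of_real pi) has_field_derivative 0) (at z)" by simp
    show "open (- (\<int> :: complex set))" by (simp add: open_Compl)
    show "of_real pi = Gamma w * Gamma (1 - w) * sin (of_real pi * w)" if "w \<in> - \<int>" for w :: complex
      using s0[of w] that by (simp add: Gamma_reflection_complex)
  qed (use notint in auto)
  ultimately have "(Gamma z * Digamma z * Gamma (1 - z) - Gamma z * (Gamma (1 - z) * Digamma (1 - z))) * sin (of_real pi * z)
      + Gamma z * Gamma (1 - z) * (of_real pi * cos (of_real pi * z)) = 0"
    by (rule DERIV_unique)
  then have "Gamma z * Gamma (1 - z) *
      ((Digamma z - Digamma (1 - z)) * sin (of_real pi * z) + of_real pi * cos (of_real pi * z)) = 0"
    by (simp add: algebra_simps)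
  then have "(Digamma z - Digamma (1 - z)) * sin (of_real pi * z) + of_real pi * cos (of_real pi * z) = 0"
    using G0 by simp
  then have refl: "Digamma (1 - z) - Digamma z = of_real pi * cot (of_real pi * z)"
    using s0[OF notint] by (simp add: cot_def field_simps)
  have z1: "1 + z \<noteq> 0" "1 - z \<noteq> 0" using z by (auto simp: add_eq_0_iff)
  have "z \<noteq> 0" using z by auto
  \<comment> \<open>The inserted terms 1 / (n + 1) make each of the two Digamma series converge;
    they cancel, as does Euler's constant.\<close>
  have "2 * z / (of_nat (Suc n) ^ 2 - z ^ 2) =
     (inverse (of_nat (Suc n)) - inverse (1 + z + of_nat n)) -
     (inverse (of_nat (Suc n)) - inverse (1 - z + of_nat n))" for n
  proof -
    have "of_nat (Suc n) + z \<noteq> 0" "of_nat (Suc n) - z \<noteq> 0"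
      using notint Ints_minus[of z] by (auto simp: add_eq_0_iff minus_equation_iff[of _ z] simp del: of_nat_Suc)
    then have "2 * z / ((of_nat (Suc n) + z) * (of_nat (Suc n) - z)) =
      inverse (of_nat (Suc n) - z) - inverse (of_nat (Suc n) + z)"
      by (simp add: divide_simps del: of_nat_Suc)
    moreover have "(of_nat (Suc n) + z) * (of_nat (Suc n) - z) = of_nat (Suc n) ^ 2 - z ^ 2"
      by (simp add: algebra_simps power2_eq_square del: of_nat_Suc)
    moreover have e: "1 + z + of_nat n = of_nat (Suc n) + z" "1 - z + of_nat n = of_nat (Suc n) - z"
      by simp_all
    ultimately show ?thesis unfolding e by (simp del: of_nat_Suc)
  qed
  moreover have "(\<lambda>n. (inverse (of_nat (Suc n)) - inverse (1 + z + of_nat n)) -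
     (inverse (of_nat (Suc n)) - inverse (1 - z + of_nat n))) sums
     ((Digamma (1 + z) + euler_mascheroni) - (Digamma (1 - z) + euler_mascheroni))"
    unfolding Digamma_def using summable_Digamma z1
    by (intro sums_diff) (auto intro: summable_sums)
  ultimately have "(\<lambda>n. 2 * z / (of_nat (Suc n) ^ 2 - z ^ 2)) sums (Digamma (z + 1) - Digamma (1 - z))"
    by (simp add: add.commute)
  then show ?thesis
    using refl Digamma_plus1[OF \<open>z \<noteq> 0\<close>] by (simp add: algebra_simps)
qed

lemma Riemann_zeta_even:
  assumes "k > 0"
  shows "(\<lambda>n. 1 / real (Suc n) ^ (2 * k)) sums Riemann_zeta (2 * real k)"
proof -
  have "(\<lambda>n. 1 / real (Suc n) powr (2 * real k)) = (\<lambda>n. 1 / real (Suc n) ^ (2 * k))"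
    by (simp add: fun_eq_iff powr_realpow[symmetric])
  moreover have "summable (\<lambda>n. 1 / real (Suc n) ^ (2 * k))"
    using inverse_power_summable[of "2 * k", where 'a = real] assms
    by (subst summable_Suc_iff) (simp add: divide_inverse)
  ultimately show ?thesis
    by (simp add: Riemann_zeta_def summable_sums)
qed

text \<open>The upper bound serves as a dominating constant; the lower bound, the first Dirichlet
  term, is what the divergence argument for the series over k uses.\<close>

lemma Riemann_zeta_even_bounds:
  "1 \<le> Riemann_zeta (2 * real k + 2)" "Riemann_zeta (2 * real k + 2) \<le> Riemann_zeta 2"
proof -
  have s: "(\<lambda>n. 1 / real (Suc n) ^ (2 * Suc m)) sums Riemann_zeta (2 * real m + 2)" for m
    using Riemann_zeta_even[of "Suc m"] by (simp add: algebra_simps)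
  have "(\<lambda>n. if n = 0 then 1 else 0 :: real) sums 1" by (rule sums_single)
  from sums_le[OF _ this s[of k]] show "1 \<le> Riemann_zeta (2 * real k + 2)" by simp
  have "1 / real (Suc n) ^ (2 * Suc k) \<le> 1 / real (Suc n) ^ (2 * Suc 0)" for n
    by (intro divide_left_mono power_increasing) auto
  from sums_le[OF this s[of k] s[of 0]]
  show "Riemann_zeta (2 * real k + 2) \<le> Riemann_zeta 2" by simp
qed

text \<open>Each partial fraction is a geometric series in z^2 / n^2; summing over n first turns the
  coefficients into zeta values. A geometric series in |z|^2 dominates the interchange.\<close>

lemma cot_power_series:
  fixes z :: complex
  assumes z: "0 < norm z" "norm z < 1"
  shows "(\<lambda>k. 2 * of_real (Riemann_zeta (2 * real k + 2)) * z ^ (2 * k + 1)) sums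
    (1 / z - of_real pi * cot (of_real pi * z))"
proof -
  define f where "f k n = 2 * z ^ (2 * k + 1) * of_real (1 / real (Suc n) ^ (2 * Suc k))" for k n :: nat
  have zs: "(\<lambda>n. 1 / real (Suc n) ^ (2 * Suc k)) sums Riemann_zeta (2 * real k + 2)" for k
    using Riemann_zeta_even[of "Suc k"] by (simp add: algebra_simps)
  have nf: "(\<lambda>n. norm (f k n)) sums (2 * norm z ^ (2 * k + 1) * Riemann_zeta (2 * real k + 2))" for k
    unfolding f_def norm_mult norm_of_real norm_power using sums_mult[OF zs[of k], of "2 * norm z ^ (2 * k + 1)"]
    by simp
  have abs: "(\<lambda>(k, n). norm (f k n)) summable_on UNIV"
  proof (rule abs_summable_double_series)
    show "summable (\<lambda>n. norm (f k n))" for k using nf sums_summable by blast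
    have "summable (\<lambda>k. 2 * norm z * Riemann_zeta 2 * (norm z ^ 2) ^ k)"
      using z by (intro summable_mult summable_geometric) (simp add: power_less_one_iff)
    moreover have "norm (\<Sum>n. norm (f k n)) \<le> 2 * norm z * Riemann_zeta 2 * (norm z ^ 2) ^ k" for k
    proof -
      have "2 * norm z ^ (2 * k + 1) * Riemann_zeta (2 * real k + 2) \<le> 2 * norm z ^ (2 * k + 1) * Riemann_zeta 2"
        by (intro mult_left_mono Riemann_zeta_even_bounds) auto
      moreover have "2 * norm z ^ (2 * k + 1) * Riemann_zeta (2 * real k + 2) \<ge> 0"
        using Riemann_zeta_even_bounds(1)[of k] by simp
      ultimately show ?thesis
        using nf[of k] by (simp add: sums_iff power_mult[symmetric] mult_ac)
    qed
    ultimately show "summable (\<lambda>k. \<Sum>n. norm (f k n))"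
      by (rule summable_comparison_test'[where N = 0])
  qed
  have row: "(\<Sum>n. f k n) = 2 * of_real (Riemann_zeta (2 * real k + 2)) * z ^ (2 * k + 1)" for k
  proof -
    have "(\<lambda>n. f k n) sums (2 * z ^ (2 * k + 1) * of_real (Riemann_zeta (2 * real k + 2)))"
      unfolding f_def by (intro sums_mult sums_of_real zs)
    then show ?thesis by (simp add: sums_iff)
  qed
  have col: "(\<Sum>k. f k n) = 2 * z / (of_nat (Suc n) ^ 2 - z ^ 2)" for n
  proof -
    have "norm z ^ 2 < of_nat (Suc n) ^ 2"
      using z by (intro power_strict_mono) auto
    then have lt: "norm (z ^ 2 / of_nat (Suc n) ^ 2) < 1"
      by (simp add: norm_divide norm_power del: of_nat_Suc)
    have ne: "of_nat (Suc n) ^ 2 - z ^ 2 \<noteq> 0"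
    proof
      assume "of_nat (Suc n) ^ 2 - z ^ 2 = 0"
      then have "z ^ 2 / of_nat (Suc n) ^ 2 = 1" using z by (auto simp del: of_nat_Suc)
      then show False using lt by simp
    qed
    have "f k n = 2 * z / of_nat (Suc n) ^ 2 * (z ^ 2 / of_nat (Suc n) ^ 2) ^ k" for k
      by (simp add: f_def power_mult power_divide power_add power2_eq_square power_mult_distrib mult_ac del: of_nat_Suc)
    moreover have "(\<lambda>k. 2 * z / of_nat (Suc n) ^ 2 * (z ^ 2 / of_nat (Suc n) ^ 2) ^ k) sums
        (2 * z / of_nat (Suc n) ^ 2 * (1 / (1 - z ^ 2 / of_nat (Suc n) ^ 2)))"
      by (intro sums_mult geometric_sums lt)
    moreover have "2 * z / of_nat (Suc n) ^ 2 * (1 / (1 - z ^ 2 / of_nat (Suc n) ^ 2)) =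
        2 * z / (of_nat (Suc n) ^ 2 - z ^ 2)"
      proof -
      have "X \<noteq> 0 \<Longrightarrow> X - Y \<noteq> 0 \<Longrightarrow> 2 * z / X * (1 / (1 - Y / X)) = 2 * z / (X - Y)" for X Y :: complex
        by (simp add: divide_simps)
      from this[OF _ ne] show ?thesis by (simp del: of_nat_Suc)
    qed
    ultimately show ?thesis by (simp add: sums_iff)
  qed
  have "(\<lambda>k. \<Sum>n. f k n) sums (\<Sum>n. \<Sum>k. f k n)"
    using double_series_columns[OF abs_summable_double_swap[OF abs]] .
  moreover have "(\<Sum>n. \<Sum>k. f k n) = 1 / z - of_real pi * cot (of_real pi * z)"
    using cot_partial_fractions[OF z] unfolding col by (simp add: sums_iff)
  ultimately show ?thesis unfolding row by simp
qed

text \<open>For z = i w / (2 pi) and q = exp (-w) the cotangent is -i (1 + q) / (1 - q), and (1 + q)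
  / (1 - q) = 1 + 2 q / (1 - q) accounts for the constant 1 / 2. The condition on
  \<open>Re w\<close> gives |q| < 1.\<close>

lemma exp_minus_geometric_expansion:
  fixes w :: complex
  assumes w: "0 < Re w" "norm w < 2 * pi"
  shows "(\<lambda>k. (-1) ^ k * of_real (Riemann_zeta (2 * real k + 2)) * (w / of_real (2 * pi)) ^ (2 * k + 1)) sums
    (of_real pi * ((\<Sum>n. exp (- w * of_nat (Suc n))) - 1 / w + 1 / 2))"
proof -
  define z where "z = \<i> * w / of_real (2 * pi)"
  have "w \<noteq> 0" using w by auto
  have z: "0 < norm z" "norm z < 1"
    using w \<open>w \<noteq> 0\<close> by (auto simp: z_def norm_divide norm_mult)
  define q where "q = exp (- w)"
  have q: "norm q < 1" using w by (simp add: q_def)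
  then have q1: "1 - q \<noteq> 0" by auto
  have "(\<lambda>n. q * q ^ n) sums (q * (1 / (1 - q)))"
    by (intro sums_mult geometric_sums q)
  moreover have "q * q ^ n = exp (- w * of_nat (Suc n))" for n
    unfolding q_def power_Suc[symmetric] by (subst exp_of_nat_mult[symmetric]) (simp add: mult.commute)
  ultimately have geo: "(\<Sum>n. exp (- w * of_nat (Suc n))) = q / (1 - q)"
    by (simp add: sums_iff)
  have cot: "cot (of_real pi * z) = - \<i> * (1 + q) / (1 - q)"
  proof -
    have e: "\<i> * (of_real pi * z) = - w / 2" by (simp add: z_def)
    define p where "p = exp (- w / 2)"
    have "p \<noteq> 0" by (simp add: p_def)
    have qp: "q = p * p" by (simp add: q_def p_def exp_add[symmetric])
    have "sin (of_real pi * z) = (p - inverse p) / (2 * \<i>)" "cos (of_real pi * z) = (p + inverse p) / 2"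
      unfolding sin_exp_eq cos_exp_eq by (simp_all add: e p_def exp_minus[symmetric])
    moreover have "(p + inverse p) / 2 / ((p - inverse p) / (2 * \<i>)) = - \<i> * (1 + q) / (1 - q)"
      using \<open>p \<noteq> 0\<close> q1 unfolding qp by (simp add: divide_simps) (simp add: algebra_simps)?
    ultimately show ?thesis by (simp only: cot_def)
  qed
  \<comment> \<open>Odd powers of z carry a factor i (-1)^k; multiplying by -i / 2 removes the i and
    the 2.\<close>
  have "(\<lambda>k. (\<i> / 2) * (2 * of_real (Riemann_zeta (2 * real k + 2)) * z ^ (2 * k + 1))) sums
    ((\<i> / 2) * (1 / z - of_real pi * cot (of_real pi * z)))"
    by (intro sums_mult cot_power_series z)
  from sums_minus[OF this] have "(\<lambda>k. - ((\<i> / 2) * (2 * of_real (Riemann_zeta (2 * real k + 2)) * z ^ (2 * k + 1)))) sums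
    (- ((\<i> / 2) * (1 / z - of_real pi * cot (of_real pi * z))))" .
  moreover have "- ((\<i> / 2) * (2 * of_real (Riemann_zeta (2 * real k + 2)) * z ^ (2 * k + 1))) =
     (-1) ^ k * of_real (Riemann_zeta (2 * real k + 2)) * (w / of_real (2 * pi)) ^ (2 * k + 1)" for k
  proof -
    have "z ^ (2 * k + 1) = \<i> * (-1) ^ k * (w / of_real (2 * pi)) ^ (2 * k + 1)"
    proof -
      have "(\<i> * v) ^ (2 * k + 1) = \<i> * (-1) ^ k * v ^ (2 * k + 1)" for v
        by (simp add: power_mult_distrib power_mult power_minus[of "v\<^sup>2"])
      from this[of "w / of_real (2 * pi)"] show ?thesis by (simp add: z_def)
    qed
    moreover have "- ((\<i> / 2) * (2 * R * (\<i> * s * v))) = s * R * v" for R s v :: complex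
      by (simp add: algebra_simps)
    ultimately show ?thesis by (simp only:)
  qed
  moreover have "- ((\<i> / 2) * (1 / z - of_real pi * cot (of_real pi * z))) =
      of_real pi * ((\<Sum>n. exp (- w * of_nat (Suc n))) - 1 / w + 1 / 2)"
    unfolding geo cot using \<open>w \<noteq> 0\<close> q1 by (simp add: z_def divide_simps) (simp add: algebra_simps)?
  ultimately show ?thesis by simp
qed

section \<open>Poisson integral representation\<close>

text \<open>The Poisson kernel (1 - t^2) powr (\<nu> - 1/2) on -1 < t < 1 after u = t^2. The total
  mass is 1 / Gamma (\<nu> + 1), the value at 0 of the normalised Bessel function.\<close>

definition poisson_weight :: "real \<Rightarrow> real \<Rightarrow> real" where
  "poisson_weight \<nu> u = u powr (- 1 / 2) * (1 - u) powr (\<nu> - 1 / 2) / (sqrt pi * Gamma (\<nu> + 1 / 2))"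

definition poisson_measure :: "real \<Rightarrow> real measure" where
  "poisson_measure \<nu> = density lborel (\<lambda>u. ennreal (indicator {0..1} u * poisson_weight \<nu> u))"

definition poisson_moment :: "real \<Rightarrow> nat \<Rightarrow> real" where
  "poisson_moment \<nu> n = Gamma (real n + 1 / 2) / (sqrt pi * Gamma (real n + \<nu> + 1))"

lemma sets_poisson_measure [simp, measurable_cong]: "sets (poisson_measure \<nu>) = sets borel"
  by (simp add: poisson_measure_def)

lemma poisson_weight_measurable [measurable]: "poisson_weight \<nu> \<in> borel_measurable borel"
  unfolding poisson_weight_def[abs_def] by measurable

text \<open>Legendre duplication, in the form that cancels the (2 m)! of the cosine series against
  the Gamma value in the moments.\<close>

lemma fact_double_Gamma: "fact (2 * n) = (4 ^ n * fact n * Gamma (real n + 1 / 2) / sqrt pi :: real)"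
proof -
  have "Gamma (real n + 1 / 2) = pochhammer (1 / 2) n * sqrt pi"
    using pochhammer_Gamma[of "1 / 2 :: real" n] nonpos_Ints_nonpos[of "1 / 2 :: real"]
    by (force simp: Gamma_one_half_real add.commute)
  then show ?thesis by (simp add: fact_double power_mult)
qed

context
  fixes \<nu> :: real
  assumes nu: "\<nu> > - 1 / 2"
begin

lemma poisson_weight_nonneg: "0 \<le> poisson_weight \<nu> u"
  using nu Gamma_real_pos[of "\<nu> + 1 / 2"] by (auto simp: poisson_weight_def)

text \<open>At both endpoints the density is 0 by the convention
  \<open>0 powr x = 0\<close>.\<close>

lemma AE_poisson_measure: "AE u in poisson_measure \<nu>. u \<in> {0<..<1}"
  unfolding poisson_measure_def
  by (subst AE_density) (auto simp: poisson_weight_def indicator_def less_le)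

lemma poisson_moment_pos: "poisson_moment \<nu> n > 0"
  unfolding poisson_moment_def using nu by (intro divide_pos_pos mult_pos_pos Gamma_real_pos) auto

lemma poisson_integrable_iff:
  assumes "f \<in> borel_measurable borel"
  shows "integrable (poisson_measure \<nu>) f \<longleftrightarrow> set_integrable lborel {0..1} (\<lambda>u. poisson_weight \<nu> u * f u)"
proof -
  have "integrable (poisson_measure \<nu>) f \<longleftrightarrow>
      integrable lborel (\<lambda>u. (indicator {0..1} u * poisson_weight \<nu> u) *\<^sub>R f u)"
    unfolding poisson_measure_def using assms poisson_weight_nonneg
    by (intro integrable_density) auto
  then show ?thesis by (simp add: set_integrable_def mult.assoc)
qed

lemma poisson_integral_eq:
  assumes "f \<in> borel_measurable borel"
  shows "integral\<^sup>L (poisson_measure \<nu>) f = (LINT u:{0..1}|lborel. poisson_weight \<nu> u * f u)"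
proof -
  have "integral\<^sup>L (poisson_measure \<nu>) f =
      integral\<^sup>L lborel (\<lambda>u. (indicator {0..1} u * poisson_weight \<nu> u) *\<^sub>R f u)"
    unfolding poisson_measure_def using assms poisson_weight_nonneg
    by (intro integral_density) auto
  then show ?thesis by (simp add: set_lebesgue_integral_def mult.assoc)
qed

text \<open>Beta integrals and the fundamental theorem of calculus deliver gauge integrals, also for
  integrands unbounded at the endpoints; with integrability known separately the value carries over
  to the measure.\<close>

lemma poisson_integral_eqI:
  assumes "f \<in> borel_measurable borel" and "integrable (poisson_measure \<nu>) f"
    and "((\<lambda>u. poisson_weight \<nu> u * f u) has_integral I) {0..1}"
  shows "integral\<^sup>L (poisson_measure \<nu>) f = I"
proof -
  have "set_integrable lborel {0..1} (\<lambda>u. poisson_weight \<nu> u * f u)"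
    using assms(2) by (simp only: poisson_integrable_iff[OF assms(1)])
  then show ?thesis
    using assms set_borel_integral_eq_integral(2)[of "{0..1}" "\<lambda>u. poisson_weight \<nu> u * f u"]
    by (simp add: poisson_integral_eq integral_unique)
qed

text \<open>The exponents keep the shape of the Beta integrand. At u = 0 both sides are 0 by the
  convention for \<open>powr\<close>, even for n = 0.\<close>

lemma poisson_weight_power:
  assumes "u \<in> {0..1}"
  shows "poisson_weight \<nu> u * u ^ n =
    u powr (real n + 1 / 2 - 1) * (1 - u) powr (\<nu> + 1 / 2 - 1) * (1 / (sqrt pi * Gamma (\<nu> + 1 / 2)))"
proof (cases "u = 0")
  case False
  then have "u powr (real n + 1 / 2 - 1) = u ^ n * u powr (- 1 / 2)"
    using assms by (simp add: powr_realpow[symmetric] powr_add[symmetric])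
  then show ?thesis by (simp add: poisson_weight_def)
qed (simp add: poisson_weight_def)

lemma poisson_integral_power:
  "integrable (poisson_measure \<nu>) (\<lambda>u. u ^ n)"
  "integral\<^sup>L (poisson_measure \<nu>) (\<lambda>u. u ^ n) = poisson_moment \<nu> n"
proof -
  have G: "Gamma (\<nu> + 1 / 2) > 0" using nu by (intro Gamma_real_pos) auto
  have "set_integrable lborel {0..1} (\<lambda>u. u powr (real n + 1 / 2 - 1) * (1 - u) powr (\<nu> + 1 / 2 - 1))"
    using nu by (intro integrable_Beta) auto
  then have "set_integrable lborel {0..1} (\<lambda>u. u powr (real n + 1 / 2 - 1) * (1 - u) powr (\<nu> + 1 / 2 - 1)
      * (1 / (sqrt pi * Gamma (\<nu> + 1 / 2))))"
    by (rule set_integrable_mult_left)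
  also have "?this \<longleftrightarrow> set_integrable lborel {0..1} (\<lambda>u. poisson_weight \<nu> u * u ^ n)"
    by (intro set_integrable_cong) (simp_all only: poisson_weight_power)
  finally show int: "integrable (poisson_measure \<nu>) (\<lambda>u. u ^ n)"
    by (subst poisson_integrable_iff) auto
  have "((\<lambda>u. u powr (real n + 1 / 2 - 1) * (1 - u) powr (\<nu> + 1 / 2 - 1)
      * (1 / (sqrt pi * Gamma (\<nu> + 1 / 2)))) has_integral
      Beta (real n + 1 / 2) (\<nu> + 1 / 2) * (1 / (sqrt pi * Gamma (\<nu> + 1 / 2)))) {0..1}"
    using nu by (intro has_integral_mult_left has_integral_Beta_real) auto
  then have "((\<lambda>u. poisson_weight \<nu> u * u ^ n) has_integral
      Beta (real n + 1 / 2) (\<nu> + 1 / 2) * (1 / (sqrt pi * Gamma (\<nu> + 1 / 2)))) {0..1}"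
    by (rule has_integral_eq[rotated]) (simp only: poisson_weight_power)
  also have "Beta (real n + 1 / 2) (\<nu> + 1 / 2) * (1 / (sqrt pi * Gamma (\<nu> + 1 / 2))) = poisson_moment \<nu> n"
    using G by (simp add: Beta_def poisson_moment_def add_ac)
  finally show "integral\<^sup>L (poisson_measure \<nu>) (\<lambda>u. u ^ n) = poisson_moment \<nu> n"
    by (intro poisson_integral_eqI int) auto
qed

lemma poisson_integral_const:
  "integrable (poisson_measure \<nu>) (\<lambda>u. c :: real)"
  "integral\<^sup>L (poisson_measure \<nu>) (\<lambda>u. c) = c * rGamma (\<nu> + 1)"
proof -
  show "integrable (poisson_measure \<nu>) (\<lambda>u. c)"
    using integrable_mult_right[OF poisson_integral_power(1)[of 0], of c] by simp
  have "(\<integral>u. c * u ^ 0 \<partial>poisson_measure \<nu>) = c * poisson_moment \<nu> 0"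
    by (simp only: integral_mult_right_zero poisson_integral_power)
  also have "poisson_moment \<nu> 0 = rGamma (\<nu> + 1)"
    by (simp add: poisson_moment_def Gamma_one_half_real rGamma_inverse_Gamma inverse_eq_divide)
  finally show "integral\<^sup>L (poisson_measure \<nu>) (\<lambda>u. c) = c * rGamma (\<nu> + 1)"
    by (simp only: power_0 mult_1_right)
qed

lemma poisson_integrable:
  assumes "f \<in> borel_measurable borel" and "\<And>u. u \<in> {0<..<1} \<Longrightarrow> \<bar>f u :: real\<bar> \<le> B"
  shows "integrable (poisson_measure \<nu>) f"
proof (rule Bochner_Integration.integrable_bound[OF poisson_integral_const(1)[of B]])
  show "f \<in> borel_measurable (poisson_measure \<nu>)" using assms by measurable
  show "AE u in poisson_measure \<nu>. norm (f u) \<le> norm B"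
    using AE_poisson_measure by eventually_elim (use assms(2) in fastforce)
qed

lemma poisson_integral_bound:
  assumes "f \<in> borel_measurable borel" and "\<And>u. u \<in> {0<..<1} \<Longrightarrow> \<bar>f u :: real\<bar> \<le> B"
  shows "\<bar>integral\<^sup>L (poisson_measure \<nu>) f\<bar> \<le> B * rGamma (\<nu> + 1)"
proof -
  have "\<bar>integral\<^sup>L (poisson_measure \<nu>) f\<bar> \<le> (\<integral>u. \<bar>f u\<bar> \<partial>poisson_measure \<nu>)"
    using integral_norm_bound[of "poisson_measure \<nu>" f] by simp
  also have "\<dots> \<le> (\<integral>u. B \<partial>poisson_measure \<nu>)"
    using poisson_integrable[OF assms] AE_poisson_measure assms(2)
    by (intro integral_mono_AE poisson_integral_const) (auto elim: eventually_mono)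
  finally show ?thesis by (simp only: poisson_integral_const)
qed

lemma poisson_integral_cong:
  assumes "f \<in> borel_measurable borel" "g \<in> borel_measurable borel"
    and "\<And>u. u \<in> {0<..<1} \<Longrightarrow> f u = (g u :: real)"
  shows "integral\<^sup>L (poisson_measure \<nu>) f = integral\<^sup>L (poisson_measure \<nu>) g"
  using assms AE_poisson_measure by (intro integral_cong_AE) (auto elim: eventually_mono)

text \<open>The measure is finite, so a summable bound uniform in u justifies the
  interchange.\<close>

lemma poisson_integral_sums:
  fixes f :: "nat \<Rightarrow> real \<Rightarrow> real"
  assumes f: "\<And>i. f i \<in> borel_measurable borel" and g: "g \<in> borel_measurable borel"
    and bound: "\<And>i u. u \<in> {0<..<1} \<Longrightarrow> \<bar>f i u\<bar> \<le> B i" and B: "summable B"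
    and sums: "\<And>u. u \<in> {0<..<1} \<Longrightarrow> (\<lambda>i. f i u) sums g u"
  shows "(\<lambda>i. integral\<^sup>L (poisson_measure \<nu>) (f i)) sums integral\<^sup>L (poisson_measure \<nu>) g"
proof -
  have "(\<lambda>i. integral\<^sup>L (poisson_measure \<nu>) (f i)) sums
      (\<integral>u. (\<Sum>i. f i u) \<partial>poisson_measure \<nu>)"
  proof (rule sums_integral)
    show "integrable (poisson_measure \<nu>) (f i)" for i
      using poisson_integrable[OF f bound] .
    show "AE u in poisson_measure \<nu>. summable (\<lambda>i. norm (f i u))"
      using AE_poisson_measure
      by eventually_elim (rule summable_comparison_test'[OF B, of 0], use bound in auto)
    show "summable (\<lambda>i. \<integral>u. norm (f i u) \<partial>poisson_measure \<nu>)"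
    proof (rule summable_comparison_test'[where N = 0])
      show "summable (\<lambda>i. B i * rGamma (\<nu> + 1))" using B by (rule summable_mult2)
      show "norm (\<integral>u. norm (f i u) \<partial>poisson_measure \<nu>) \<le> B i * rGamma (\<nu> + 1)" for i
        unfolding real_norm_def using f bound by (intro poisson_integral_bound) auto
    qed
  qed
  also have "(\<integral>u. (\<Sum>i. f i u) \<partial>poisson_measure \<nu>) = integral\<^sup>L (poisson_measure \<nu>) g"
    using sums f g by (intro poisson_integral_cong) (auto simp: sums_iff)
  finally show ?thesis .
qed

section \<open>Size of the moments\<close>

lemma poisson_moment_le: "poisson_moment \<nu> n \<le> rGamma (\<nu> + 1)"
proof -
  have "\<bar>\<integral>u. u ^ n \<partial>poisson_measure \<nu>\<bar> \<le> 1 * rGamma (\<nu> + 1)"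
    by (intro poisson_integral_bound) (auto simp: power_le_one)
  then show ?thesis by (simp add: poisson_integral_power)
qed

lemma poisson_moment_Suc:
  "poisson_moment \<nu> (Suc n) = poisson_moment \<nu> n * ((real n + 1 / 2) / (real n + \<nu> + 1))"
proof -
  have "Gamma ((real n + 1 / 2) + 1) = (real n + 1 / 2) * Gamma (real n + 1 / 2)"
    by (rule Gamma_plus1) (auto dest: nonpos_Ints_nonpos)
  moreover have "Gamma ((real n + \<nu> + 1) + 1) = (real n + \<nu> + 1) * Gamma (real n + \<nu> + 1)"
    using nu by (intro Gamma_plus1) (auto dest: nonpos_Ints_nonpos)
  ultimately show ?thesis by (simp add: poisson_moment_def add_ac mult_ac)
qed

text \<open>Consecutive moments have ratio tending to 1, so the moments divided by r^n are
  eventually nondecreasing; \<open>\<kappa>\<close> is the minimum over the initial indices.\<close>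

lemma poisson_moment_lower_bound:
  assumes "0 < r" "r < 1"
  obtains \<kappa> where "\<kappa> > 0" "\<And>n. poisson_moment \<nu> n \<ge> \<kappa> * r ^ n"
proof -
  define v where "v n = poisson_moment \<nu> n / r ^ n" for n
  have v0: "v n > 0" for n using poisson_moment_pos assms by (simp add: v_def)
  \<comment> \<open>From M on, r (n + \<nu> + 1) \<le> n + 1/2, that is, the ratio of consecutive
    moments is at least r.\<close>
  obtain M where M: "real M \<ge> \<bar>\<nu> + 1\<bar> / (1 - r)" using real_arch_simple by blast
  have step: "v n \<le> v (Suc n)" if "n \<ge> M" for n
  proof -
    have "\<bar>\<nu> + 1\<bar> / (1 - r) \<le> real n" using M that by linarith
    then have "\<bar>\<nu> + 1\<bar> \<le> real n * (1 - r)" using assms by (simp add: field_simps)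
    moreover have "r * (\<nu> + 1) \<le> \<bar>\<nu> + 1\<bar>"
      using assms nu by (simp add: abs_if mult_left_le_one_le)
    ultimately have "r * (real n + \<nu> + 1) \<le> real n + 1 / 2" by (simp add: algebra_simps)
    then have "1 \<le> (real n + 1 / 2) / (real n + \<nu> + 1) / r"
      using assms nu by (simp add: pos_le_divide_eq mult.commute)
    then have "v n * 1 \<le> v n * ((real n + 1 / 2) / (real n + \<nu> + 1) / r)"
      using v0[of n] by (intro mult_left_mono) auto
    also have "\<dots> = v (Suc n)" by (simp add: v_def poisson_moment_Suc)
    finally show ?thesis by simp
  qed
  have ge: "v M \<le> v n" if "n \<ge> M" for n
    using that by (induction rule: dec_induct) (use step order_trans in blast)+
  define \<kappa> where "\<kappa> = Min (v ` {..M})"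
  have "\<kappa> > 0" unfolding \<kappa>_def using v0 by (subst Min_gr_iff) auto
  moreover have "\<kappa> \<le> v n" for n
  proof (cases "n \<le> M")
    case False
    moreover have "\<kappa> \<le> v M" unfolding \<kappa>_def by (intro Min_le) auto
    ultimately show ?thesis using ge[of n] by simp
  qed (auto simp: \<kappa>_def)
  then have "poisson_moment \<nu> n \<ge> \<kappa> * r ^ n" for n
    using assms by (simp add: v_def field_simps)
  ultimately show ?thesis using that by blast
qed

text \<open>The cosine series is integrated term by term; (2 m)! \<ge> m! gives the uniform bound
  x^(2 m) / m!, and duplication turns each moment into a Bessel coefficient.\<close>

lemma poisson_integral_cos:
  "(\<lambda>m. (-1) ^ m * rGamma (real m + \<nu> + 1) / fact m * (x / 2) ^ (2 * m)) sums
    (\<integral>u. cos (x * sqrt u) \<partial>poisson_measure \<nu>)"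
proof -
  have "(\<lambda>m. \<integral>u. (-1) ^ m / fact (2 * m) * x ^ (2 * m) * u ^ m \<partial>poisson_measure \<nu>) sums
      (\<integral>u. cos (x * sqrt u) \<partial>poisson_measure \<nu>)"
  proof (rule poisson_integral_sums)
    show "summable (\<lambda>m. inverse (fact m) * (x\<^sup>2) ^ m)" by (rule summable_exp)
    fix m :: nat and u :: real assume u: "u \<in> {0<..<1}"
    have "fact m \<le> (fact (2 * m) :: real)" by (intro fact_mono) auto
    then have "1 / fact (2 * m) * x ^ (2 * m) * u ^ m \<le> 1 / fact m * x ^ (2 * m) * 1"
      using u by (intro mult_mono divide_left_mono power_le_one) auto
    then show "\<bar>(-1) ^ m / fact (2 * m) * x ^ (2 * m) * u ^ m\<bar> \<le> inverse (fact m) * (x\<^sup>2) ^ m"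
      using u by (simp add: abs_mult power_mult divide_inverse)
    have "(\<lambda>m. (-1) ^ m / fact (2 * m) * (x * sqrt u) ^ (2 * m)) sums cos (x * sqrt u)"
      by (rule cos_paired)
    moreover have "(-1) ^ m / fact (2 * m) * (x * sqrt u) ^ (2 * m) =
        (-1) ^ m / fact (2 * m) * x ^ (2 * m) * u ^ m" for m
      using u by (simp add: power_mult_distrib power_mult)
    ultimately show "(\<lambda>m. (-1) ^ m / fact (2 * m) * x ^ (2 * m) * u ^ m) sums cos (x * sqrt u)"
      by (simp only:)
  qed auto
  also have "(\<lambda>m. \<integral>u. (-1) ^ m / fact (2 * m) * x ^ (2 * m) * u ^ m \<partial>poisson_measure \<nu>) =
      (\<lambda>m. (-1) ^ m * rGamma (real m + \<nu> + 1) / fact m * (x / 2) ^ (2 * m))"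
  proof
    fix m
    have "0 < Gamma (real m + 1 / 2)" by (intro Gamma_real_pos) auto
    then have "Gamma (real m + 1 / 2) \<noteq> 0" by (rule less_imp_neq[THEN not_sym])
    moreover have "(x / 2) ^ (2 * m) = x ^ (2 * m) / 4 ^ m"
      by (simp add: power_divide power_mult)
    moreover have "rGamma (real m + \<nu> + 1) = 1 / Gamma (real m + \<nu> + 1)"
      by (simp add: rGamma_inverse_Gamma inverse_eq_divide)
    ultimately have "(-1) ^ m / fact (2 * m) * x ^ (2 * m) * poisson_moment \<nu> m =
        (-1) ^ m * rGamma (real m + \<nu> + 1) / fact m * (x / 2) ^ (2 * m)"
      unfolding fact_double_Gamma poisson_moment_def by simp
    then show "(\<integral>u. (-1) ^ m / fact (2 * m) * x ^ (2 * m) * u ^ m \<partial>poisson_measure \<nu>) =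
      (-1) ^ m * rGamma (real m + \<nu> + 1) / fact m * (x / 2) ^ (2 * m)"
      by (simp only: poisson_integral_power integral_mult_right_zero)
  qed
  finally show ?thesis .
qed

lemma Bessel_J_div_powr:
  assumes "x > 0"
  shows "Bessel_J \<nu> x / (x / 2) powr \<nu> = (\<integral>u. cos (x * sqrt u) \<partial>poisson_measure \<nu>)"
  using assms poisson_integral_cos[of x] by (simp add: Bessel_J_def sums_iff)

end

section \<open>The Stieltjes transform of the Poisson weight\<close>

context
  fixes \<nu> :: real
  assumes nu: "\<nu> > - 1 / 2"
begin

text \<open>The square root cancels the singularity at 0 and leaves a Beta value; it determines the
  limit of the pole term as s -> 0+.\<close>

lemma poisson_integral_sqrt:
  "(\<integral>u. sqrt u \<partial>poisson_measure \<nu>) = 1 / (sqrt pi * Gamma (\<nu> + 1 / 2) * (\<nu> + 1 / 2))"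
proof (rule poisson_integral_eqI[OF nu])
  show "integrable (poisson_measure \<nu>) sqrt"
    by (rule poisson_integrable[OF nu, where B = 1]) auto
  have "((\<lambda>u. u powr (1 - 1) * (1 - u) powr (\<nu> + 1 / 2 - 1) * (1 / (sqrt pi * Gamma (\<nu> + 1 / 2)))) has_integral
      Beta 1 (\<nu> + 1 / 2) * (1 / (sqrt pi * Gamma (\<nu> + 1 / 2)))) {0..1}"
    using nu by (intro has_integral_mult_left has_integral_Beta_real) auto
  moreover have "Beta 1 (\<nu> + 1 / 2) = 1 / (\<nu> + 1 / 2)"
  proof -
    have "\<nu> + 1 / 2 \<notin> \<int>\<^sub>\<le>\<^sub>0" using nu by (auto dest: nonpos_Ints_nonpos)
    moreover from this have "Gamma (\<nu> + 1 / 2) \<noteq> 0" by (simp add: Gamma_eq_zero_iff)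
    ultimately show ?thesis using Gamma_plus1[of "\<nu> + 1 / 2"] by (simp add: Beta_def add_ac)
  qed
  ultimately have "((\<lambda>u. u powr (1 - 1) * (1 - u) powr (\<nu> + 1 / 2 - 1) * (1 / (sqrt pi * Gamma (\<nu> + 1 / 2)))) has_integral
      1 / (sqrt pi * Gamma (\<nu> + 1 / 2) * (\<nu> + 1 / 2))) {0..1}"
    by (simp add: mult_ac)
  then show "((\<lambda>u. poisson_weight \<nu> u * sqrt u) has_integral
      1 / (sqrt pi * Gamma (\<nu> + 1 / 2) * (\<nu> + 1 / 2))) {0..1}"
  proof (rule has_integral_eq[rotated])
    show "u powr (1 - 1) * (1 - u) powr (\<nu> + 1 / 2 - 1) * (1 / (sqrt pi * Gamma (\<nu> + 1 / 2))) =
        poisson_weight \<nu> u * sqrt u" if "u \<in> {0..1}" for u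
    proof (cases "u = 0")
      case False
      then have "u powr (- 1 / 2) * sqrt u = 1"
        using that by (simp add: powr_half_sqrt[symmetric] powr_add[symmetric])
      then show ?thesis using False by (simp add: poisson_weight_def mult_ac)
    qed (simp add: poisson_weight_def)
  qed
qed auto

text \<open>For w = a + i b sqrt u and s = a / b, Re (1 / w) is a / b^2 times 1 / (s^2 + u); the
  pole term therefore integrates to s * \<open>stieltjes\<close> (s^2) / b.\<close>

definition stieltjes :: "real \<Rightarrow> real" where
  "stieltjes v = (\<integral>u. 1 / (v + u) \<partial>poisson_measure \<nu>)"

definition stieltjes' :: "real \<Rightarrow> real" where
  "stieltjes' v = (\<integral>u. 1 / (v + u) ^ 2 \<partial>poisson_measure \<nu>)"

lemma integrable_stieltjes:
  assumes "v > 0"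
  shows "integrable (poisson_measure \<nu>) (\<lambda>u. 1 / (v + u))"
    and "integrable (poisson_measure \<nu>) (\<lambda>u. 1 / (v + u) ^ 2)"
  using assms
  by (intro poisson_integrable[OF nu, where B = "1 / v"] poisson_integrable[OF nu, where B = "1 / v ^ 2"];
      force intro!: divide_left_mono power_mono)+

text \<open>The error of the difference quotient has integrand (w - v) / ((v + u)^2 (w + u)), which
  for w > v / 2 is at most 2 / v^3 times |w - v| in absolute value, uniformly in u.\<close>

lemma DERIV_stieltjes:
  assumes v: "v > 0"
  shows "(stieltjes has_field_derivative - stieltjes' v) (at v)"
  unfolding has_field_derivative_iff
proof (rule LIM_zero_cancel, rule Lim_null_comparison)
  define B where "B = 2 / v ^ 3 * rGamma (\<nu> + 1)"
  have "\<forall>\<^sub>F w in at v. w \<in> {v / 2<..}"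
    using v by (intro topological_tendstoD[OF tendsto_ident_at]) auto
  moreover have "\<forall>\<^sub>F w in at v. w \<noteq> v" by (simp add: eventually_at_filter)
  ultimately show "\<forall>\<^sub>F w in at v. norm ((stieltjes w - stieltjes v) / (w - v) - (- stieltjes' v)) \<le> \<bar>w - v\<bar> * B"
  proof eventually_elim
    case (elim w)
    then have w: "w > v / 2" "w > 0" "w \<noteq> v" using v by auto
    have "(stieltjes w - stieltjes v) / (w - v) - (- stieltjes' v) =
        (\<integral>u. (1 / (w + u) - 1 / (v + u)) / (w - v) + 1 / (v + u) ^ 2 \<partial>poisson_measure \<nu>)"
      using integrable_stieltjes[OF v] integrable_stieltjes[OF w(2)]
      by (simp add: stieltjes_def stieltjes'_def)
    also have "\<bar>\<dots>\<bar> \<le> \<bar>w - v\<bar> * (2 / v ^ 3) * rGamma (\<nu> + 1)"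
    proof (rule poisson_integral_bound[OF nu])
      fix u :: real assume u: "u \<in> {0<..<1}"
      have "(1 / q - 1 / p) / (q - p) + 1 / p ^ 2 = (q - p) / (p ^ 2 * q)"
        if "p > 0" "q > 0" "q \<noteq> p" for p q :: real
        using that by (simp add: divide_simps power2_eq_square) (simp add: algebra_simps)
      from this[of "v + u" "w + u"]
      have "(1 / (w + u) - 1 / (v + u)) / (w - v) + 1 / (v + u) ^ 2 = (w - v) / ((v + u) ^ 2 * (w + u))"
        using u v w by simp
      also have "\<bar>\<dots>\<bar> = \<bar>w - v\<bar> / ((v + u) ^ 2 * (w + u))"
        using u v w by (simp add: abs_mult)
      also have "\<dots> \<le> \<bar>w - v\<bar> / (v ^ 2 * (v / 2))"
        using u v w by (intro divide_left_mono mult_mono power_mono) auto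
      finally show "\<bar>(1 / (w + u) - 1 / (v + u)) / (w - v) + 1 / (v + u) ^ 2\<bar> \<le> \<bar>w - v\<bar> * (2 / v ^ 3)"
        by (simp add: power2_eq_square power3_eq_cube)
    qed measurable
    finally show ?case by (simp add: B_def)
  qed
  show "((\<lambda>w. \<bar>w - v\<bar> * B) \<longlongrightarrow> 0) (at v)"
    by (auto intro!: tendsto_eq_intros)
  qed

text \<open>Integration by parts: raising both exponents of the weight by one and dividing by v + u
  gives a function vanishing at both endpoints, so its derivative integrates to 0.\<close>

lemma stieltjes'_eq:
  assumes s: "s > 0"
  shows "s\<^sup>2 * (1 + s\<^sup>2) * stieltjes' (s\<^sup>2) = \<nu> * rGamma (\<nu> + 1) + (1 / 2 + (1 - \<nu>) * s\<^sup>2) * stieltjes (s\<^sup>2)"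
proof -
  define c where "c = 1 / (sqrt pi * Gamma (\<nu> + 1 / 2))"
  define v where "v = s\<^sup>2"
  have v: "v > 0" using s by (simp add: v_def)
  \<comment> \<open>The derivative of \<open>?F\<close> below, divided by the weight and written in
    partial fractions in v + u.\<close>
  define \<phi> where "\<phi> u = - \<nu> + (1 / 2 + (\<nu> + 1) * v - (1 + 2 * v)) * (1 / (v + u)) + v * (1 + v) * (1 / (v + u) ^ 2)" for u
  have int: "has_bochner_integral (poisson_measure \<nu>) \<phi> (- \<nu> * rGamma (\<nu> + 1) +
      (1 / 2 + (\<nu> + 1) * v - (1 + 2 * v)) * stieltjes v + v * (1 + v) * stieltjes' v)"
    unfolding \<phi>_def stieltjes_def stieltjes'_def
    using integrable_stieltjes[OF v] poisson_integral_const[OF nu, of "- \<nu>"]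
    by (intro has_bochner_integral_add has_bochner_integral_mult_right)
       (simp_all only: has_bochner_integral_iff)
  let ?F = "\<lambda>u. c * (sqrt u * (1 - u) powr (\<nu> + 1 / 2) / (v + u))"
  have "integral\<^sup>L (poisson_measure \<nu>) \<phi> = ?F 1 - ?F 0"
  proof (rule poisson_integral_eqI[OF nu _ has_bochner_integral_iff[THEN iffD1, OF int, THEN conjunct1]])
    show "\<phi> \<in> borel_measurable borel" unfolding \<phi>_def by measurable
    show "((\<lambda>u. poisson_weight \<nu> u * \<phi> u) has_integral ?F 1 - ?F 0) {0..1}"
    proof (rule fundamental_theorem_of_calculus_interior)
      show "continuous_on {0..1} ?F"
        using v nu by (intro continuous_on_powr' continuous_intros) auto
      fix u :: real assume u: "u \<in> {0<..<1}"
      define p where "p = (1 - u) powr (\<nu> - 1 / 2)"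
      define q where "q = sqrt u"
      have q: "q > 0" "u = q * q" using u by (auto simp: q_def)
      have pw: "(1 - u) powr (\<nu> + 1 / 2) = (1 - u) * p"
        using u by (simp add: p_def powr_mult_base add.commute)
      have pw': "(1 - u) powr (\<nu> + 1 / 2 - 1) = p" by (simp add: p_def)
      have q': "u powr (- 1 / 2) = 1 / q"
        using u by (simp add: q_def powr_minus_divide powr_half_sqrt)
      have "(?F has_real_derivative
        c * (((inverse q / 2) * (1 - u) powr (\<nu> + 1 / 2) +
          q * (- ((\<nu> + 1 / 2) * (1 - u) powr (\<nu> + 1 / 2 - 1)))) * (v + u)
          - q * (1 - u) powr (\<nu> + 1 / 2)) / (v + u) ^ 2) (at u)"
        using u v unfolding q_def
        by (auto intro!: derivative_eq_intros simp: power2_eq_square algebra_simps)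
      also have "c * (((inverse q / 2) * (1 - u) powr (\<nu> + 1 / 2) +
          q * (- ((\<nu> + 1 / 2) * (1 - u) powr (\<nu> + 1 / 2 - 1)))) * (v + u)
          - q * (1 - u) powr (\<nu> + 1 / 2)) / (v + u) ^ 2 = poisson_weight \<nu> u * \<phi> u"
      proof -
        have "v + q * q > 0" using q v by (simp add: add_pos_pos)
        then have "((inverse q / 2 * ((1 - q * q) * p) + q * (- ((\<nu> + 1 / 2) * p))) * (v + q * q) - q * ((1 - q * q) * p)) / (v + q * q) ^ 2
          = 1 / q * p * (- \<nu> + (1 / 2 + (\<nu> + 1) * v - (1 + 2 * v)) * (1 / (v + q * q)) + v * (1 + v) * (1 / (v + q * q) ^ 2))"
          using q(1) by (simp add: divide_simps) (simp add: algebra_simps power2_eq_square)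
        from arg_cong[OF this[folded q(2)], of "\<lambda>t. c * t"]
        have "c * (((inverse q / 2 * ((1 - u) * p) + q * (- ((\<nu> + 1 / 2) * p))) * (v + u) - q * ((1 - u) * p)) / (v + u) ^ 2) =
            c * (1 / q * p) * \<phi> u"
          unfolding \<phi>_def by (simp only: mult.assoc)
        moreover have "poisson_weight \<nu> u = c * (1 / q * p)"
          unfolding poisson_weight_def q' c_def p_def by simp
        ultimately show ?thesis
          unfolding pw pw' by (simp only: times_divide_eq_right)
      qed
      finally show "(?F has_vector_derivative poisson_weight \<nu> u * \<phi> u) (at u)"
        by (simp add: has_real_derivative_iff_has_vector_derivative)
    qed simp
  qed
  then have "- \<nu> * rGamma (\<nu> + 1) + (1 / 2 + (\<nu> + 1) * v - (1 + 2 * v)) * stieltjes v + v * (1 + v) * stieltjes' v = 0"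
    unfolding has_bochner_integral_integral_eq[OF int] by simp
  then show ?thesis unfolding v_def[symmetric] by (simp add: algebra_simps)
qed

lemma DERIV_poisson_kernel:
  assumes s: "s > 0"
  shows "((\<lambda>s. s * stieltjes (s\<^sup>2)) has_field_derivative
    ((2 * \<nu> - 1) * s * (s * stieltjes (s\<^sup>2)) - 2 * rGamma \<nu>) / (1 + s\<^sup>2)) (at s)"
proof -
  have "((\<lambda>s. s * stieltjes (s\<^sup>2)) has_field_derivative
    stieltjes (s\<^sup>2) + s * (- stieltjes' (s\<^sup>2) * (2 * s))) (at s)"
    using s by (auto intro!: derivative_eq_intros DERIV_chain2[OF DERIV_stieltjes])
  also have "stieltjes (s\<^sup>2) + s * (- stieltjes' (s\<^sup>2) * (2 * s)) =
      ((2 * \<nu> - 1) * s * (s * stieltjes (s\<^sup>2)) - 2 * rGamma \<nu>) / (1 + s\<^sup>2)"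
  proof -
    have "1 + s\<^sup>2 \<noteq> 0" by (metis add_pos_nonneg less_irrefl zero_le_power2 zero_less_one)
    moreover have "(stieltjes (s\<^sup>2) + s * (- stieltjes' (s\<^sup>2) * (2 * s))) * (1 + s\<^sup>2) =
        (1 + s\<^sup>2) * stieltjes (s\<^sup>2) - 2 * (s\<^sup>2 * (1 + s\<^sup>2) * stieltjes' (s\<^sup>2))"
      by (simp add: algebra_simps power2_eq_square)
    \<comment> \<open>The term 1 / Gamma \<nu> arises here as \<nu> *
      \<open>rGamma (\<nu> + 1)\<close>, which includes its value 0 at \<nu> = 0.\<close>
    moreover have "\<dots> = (2 * \<nu> - 1) * s * (s * stieltjes (s\<^sup>2)) - 2 * rGamma \<nu>"
      unfolding stieltjes'_eq[OF s] rGamma_plus1[of \<nu>, symmetric]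
      by (simp add: algebra_simps power2_eq_square)
    ultimately show ?thesis by (simp add: eq_divide_eq)
  qed
  finally show ?thesis .
qed

text \<open>This yields the initial value of the differential equation at s = 0+. A primitive
  containing arctan (sqrt u / s), zero at both endpoints, trades the singular kernel s / (s^2 + u)
  for an arctangent that tends boundedly to pi / 2.\<close>

lemma poisson_kernel_bound:
  assumes s: "s > 0"
  shows "\<bar>(1 + s\<^sup>2) * (s * stieltjes (s\<^sup>2)) - s * rGamma (\<nu> + 1) - sqrt pi / Gamma (\<nu> + 1 / 2)\<bar>
    \<le> (2 * \<nu> + 1) * (s * rGamma (\<nu> + 1))"
proof -
  define c where "c = 1 / (sqrt pi * Gamma (\<nu> + 1 / 2))"
  have v: "s\<^sup>2 > 0" using s by simp
  let ?\<psi> = "\<lambda>u. sqrt u * arctan (sqrt u / s)"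
  define \<phi> where "\<phi> u = - (2 * \<nu> + 1) * ?\<psi> u + (s * (1 + s\<^sup>2) * (1 / (s\<^sup>2 + u)) - s)" for u
  have psi: "\<bar>?\<psi> u\<bar> \<le> 2" if "u \<in> {0<..<1}" for u
  proof -
    have "sqrt u \<le> 1" "\<bar>arctan (sqrt u / s)\<bar> \<le> 2"
      using that arctan_bounded[of "sqrt u / s"] pi_less_4 by (auto simp: abs_if)
    then have "\<bar>sqrt u\<bar> * \<bar>arctan (sqrt u / s)\<bar> \<le> 1 * 2"
      using that by (intro mult_mono) auto
    then show ?thesis by (simp add: abs_mult)
  qed
  have intpsi: "integrable (poisson_measure \<nu>) ?\<psi>"
    by (rule poisson_integrable[OF nu _ psi]) measurable
  have int: "has_bochner_integral (poisson_measure \<nu>) \<phi>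
      (- (2 * \<nu> + 1) * integral\<^sup>L (poisson_measure \<nu>) ?\<psi> + (s * (1 + s\<^sup>2) * stieltjes (s\<^sup>2) - s * rGamma (\<nu> + 1)))"
    unfolding \<phi>_def stieltjes_def
    using integrable_stieltjes[OF v] poisson_integral_const[OF nu, of s] intpsi
    by (intro has_bochner_integral_add has_bochner_integral_diff has_bochner_integral_mult_right)
       (simp_all only: has_bochner_integral_iff)
  let ?F = "\<lambda>u. 2 * c * ((1 - u) powr (\<nu> + 1 / 2) * arctan (sqrt u / s))"
  have "integral\<^sup>L (poisson_measure \<nu>) \<phi> = ?F 1 - ?F 0"
  proof (rule poisson_integral_eqI[OF nu _ has_bochner_integral_iff[THEN iffD1, OF int, THEN conjunct1]])
    show "\<phi> \<in> borel_measurable borel" unfolding \<phi>_def by measurable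
    show "((\<lambda>u. poisson_weight \<nu> u * \<phi> u) has_integral ?F 1 - ?F 0) {0..1}"
    proof (rule fundamental_theorem_of_calculus_interior)
      show "continuous_on {0..1} ?F"
        using s nu by (intro continuous_on_powr' continuous_intros) auto
      fix u :: real assume u: "u \<in> {0<..<1}"
      define p where "p = (1 - u) powr (\<nu> - 1 / 2)"
      define q where "q = sqrt u"
      have q: "q > 0" "u = q * q" using u by (auto simp: q_def)
      have pw: "(1 - u) powr (\<nu> + 1 / 2) = (1 - u) * p"
        using u by (simp add: p_def powr_mult_base add.commute)
      have pw': "(1 - u) powr (\<nu> + 1 / 2 - 1) = p" by (simp add: p_def)
      have q': "u powr (- 1 / 2) = 1 / q"
        using u by (simp add: q_def powr_minus_divide powr_half_sqrt)
      have "(?F has_real_derivative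
        2 * c * (- ((\<nu> + 1 / 2) * (1 - u) powr (\<nu> + 1 / 2 - 1)) * arctan (q / s) +
          (1 - u) powr (\<nu> + 1 / 2) * (inverse (1 + (q / s)\<^sup>2) * ((inverse q / 2) / s)))) (at u)"
        using u s unfolding q_def
        by (auto intro!: derivative_eq_intros)
      also have "2 * c * (- ((\<nu> + 1 / 2) * (1 - u) powr (\<nu> + 1 / 2 - 1)) * arctan (q / s) +
          (1 - u) powr (\<nu> + 1 / 2) * (inverse (1 + (q / s)\<^sup>2) * ((inverse q / 2) / s))) = poisson_weight \<nu> u * \<phi> u"
      proof -
        have pos: "s\<^sup>2 + q * q > 0" using q v by (simp add: add_pos_pos)
        have 1: "inverse (1 + (q / s)\<^sup>2) = s\<^sup>2 / (s\<^sup>2 + q * q)"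
          using s pos by (simp add: field_simps power2_eq_square)
        have "2 * (- ((\<nu> + 1 / 2) * p) * A + ((1 - q * q) * p) * (s\<^sup>2 / (s\<^sup>2 + q * q) * ((inverse q / 2) / s))) =
          1 / q * p * (- (2 * \<nu> + 1) * (q * A) + (s * (1 + s\<^sup>2) * (1 / (s\<^sup>2 + q * q)) - s))" for A
          using q(1) s pos by (simp add: divide_simps) (simp add: algebra_simps power2_eq_square)
        from this[of "arctan (q / s)"] show ?thesis
          unfolding poisson_weight_def \<phi>_def pw pw' q' 1 p_def[symmetric] q_def[symmetric] c_def
          by (simp add: q(2))
      qed
      finally show "(?F has_vector_derivative poisson_weight \<nu> u * \<phi> u) (at u)"
        by (simp add: has_real_derivative_iff_has_vector_derivative)
    qed simp
  qed
  then have eq: "(1 + s\<^sup>2) * (s * stieltjes (s\<^sup>2)) - s * rGamma (\<nu> + 1) = (2 * \<nu> + 1) * integral\<^sup>L (poisson_measure \<nu>) ?\<psi>"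
    unfolding has_bochner_integral_integral_eq[OF int] by (simp add: algebra_simps)
  have intsqrt: "integrable (poisson_measure \<nu>) (\<lambda>u. pi / 2 * sqrt u)"
    by (rule poisson_integrable[OF nu, where B = "pi / 2"]) (auto simp: abs_mult)
  have "sqrt pi / Gamma (\<nu> + 1 / 2) = (2 * \<nu> + 1) * (pi / 2 * (\<integral>u. sqrt u \<partial>poisson_measure \<nu>))"
  proof -
    have "p / g = 2 * k * (p * p / 2 * (1 / (p * g * k)))" if "p \<noteq> 0" "k \<noteq> 0" for p g k :: real
      using that by simp
    from this[of "sqrt pi" "\<nu> + 1 / 2" "Gamma (\<nu> + 1 / 2)"] show ?thesis
      unfolding poisson_integral_sqrt using nu by (simp add: distrib_left)
  qed
  then have "(1 + s\<^sup>2) * (s * stieltjes (s\<^sup>2)) - s * rGamma (\<nu> + 1) - sqrt pi / Gamma (\<nu> + 1 / 2) =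
     (2 * \<nu> + 1) * (\<integral>u. ?\<psi> u - pi / 2 * sqrt u \<partial>poisson_measure \<nu>)"
    unfolding eq using intpsi intsqrt by (simp add: algebra_simps)
  \<comment> \<open>The arctangent falls short of pi / 2 by arctan (s / sqrt u) \<le> s / sqrt u,
    and the factor sqrt u makes this uniform in u.\<close>
  moreover have "\<bar>\<integral>u. ?\<psi> u - pi / 2 * sqrt u \<partial>poisson_measure \<nu>\<bar> \<le> s * rGamma (\<nu> + 1)"
  proof (rule poisson_integral_bound[OF nu])
    fix u :: real assume u: "u \<in> {0<..<1}"
    have "arctan (s / sqrt u) \<le> s / sqrt u" "arctan (s / sqrt u) \<ge> 0"
      using u s arctan_le_self[of "s / sqrt u"] by auto
    then have "sqrt u * arctan (s / sqrt u) \<le> s" "sqrt u * arctan (s / sqrt u) \<ge> 0"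
      using u by (simp_all add: field_simps)
    moreover have "arctan (s / sqrt u) = pi / 2 - arctan (sqrt u / s)"
      using arctan_inverse[of "sqrt u / s"] u s by (simp add: sgn_if)
    then have "?\<psi> u - pi / 2 * sqrt u = - (sqrt u * arctan (s / sqrt u))"
      by (simp only:) (simp add: algebra_simps)
    ultimately show "\<bar>?\<psi> u - pi / 2 * sqrt u\<bar> \<le> s" by simp
  qed measurable
  ultimately show ?thesis
    using nu by (simp add: abs_mult mult_left_mono)
qed

end

section \<open>The Gauss hypergeometric term\<close>

context
  fixes \<nu> :: real
  assumes nu: "\<nu> > - 1 / 2"
begin

text \<open>Coefficients of s times the Gauss function at -s^2 as an odd series in s. For \<nu> =
  1/2 they are (-1)^k / (2 k + 1), those of the arctangent.\<close>

definition arc_coeff :: "nat \<Rightarrow> real" where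
  "arc_coeff k = (-1) ^ k * pochhammer (1 - \<nu>) k / pochhammer (3 / 2) k"

lemma arc_coeff_Suc: "(2 * real k + 3) * arc_coeff (Suc k) = - (2 * real k + 2 - 2 * \<nu>) * arc_coeff k"
proof -
  have "pochhammer (3 / 2 :: real) k > 0" by (intro pochhammer_pos) auto
  then show ?thesis
    by (simp add: arc_coeff_def pochhammer_Suc divide_simps) (simp add: algebra_simps)
qed

text \<open>Euler's limit for 1 / Gamma, applied to both Pochhammer symbols, gives the rate n powr
  (- \<nu> - 1/2); the exponent is negative because \<nu> > -1/2.\<close>

lemma arc_coeff_tendsto_0: "arc_coeff \<longlonglongrightarrow> 0"
proof -
  have "(\<lambda>n. rGamma_series (1 - \<nu>) n / rGamma_series (3 / 2) n * real n powr (- \<nu> - 1 / 2))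
      \<longlonglongrightarrow> rGamma (1 - \<nu>) / rGamma (3 / 2) * 0"
  proof (intro tendsto_mult tendsto_divide rGamma_series_LIMSEQ)
    show "(\<lambda>n. real n powr (- \<nu> - 1 / 2)) \<longlonglongrightarrow> 0"
      using nu by (intro tendsto_neg_powr filterlim_real_sequentially) auto
    show "rGamma (3 / 2 :: real) \<noteq> 0"
      using nonpos_Ints_nonpos[of "3 / 2 :: real"] by (auto simp: rGamma_eq_zero_iff)
  qed
  moreover have "\<forall>\<^sub>F n in sequentially.
      rGamma_series (1 - \<nu>) n / rGamma_series (3 / 2) n * real n powr (- \<nu> - 1 / 2) =
      (-1) ^ Suc n * arc_coeff (Suc n)"
    using eventually_gt_at_top[of 0]
  proof eventually_elim
    case (elim n)
    have e: "exp (z * of_real (ln (of_nat n))) = real n powr z" for z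
      using elim by (simp add: powr_def)
    have "real n powr (3 / 2) / real n powr (1 - \<nu>) * real n powr (- \<nu> - 1 / 2) = 1"
      using elim by (simp add: powr_diff[symmetric] powr_add[symmetric])
    moreover have "rGamma_series (1 - \<nu>) n / rGamma_series (3 / 2) n =
        pochhammer (1 - \<nu>) (Suc n) / pochhammer (3 / 2) (Suc n) * (real n powr (3 / 2) / real n powr (1 - \<nu>))"
      unfolding rGamma_series_def e by simp
    ultimately have "rGamma_series (1 - \<nu>) n / rGamma_series (3 / 2) n * real n powr (- \<nu> - 1 / 2) =
        pochhammer (1 - \<nu>) (Suc n) / pochhammer (3 / 2) (Suc n)"
      by (simp only: mult.assoc mult_1_right)
    also have "\<dots> = (-1) ^ Suc n * arc_coeff (Suc n)"
      by (simp add: arc_coeff_def flip: power_add mult_2)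
    finally show ?case .
  qed
  ultimately have "(\<lambda>n. (-1) ^ Suc n * arc_coeff (Suc n)) \<longlonglongrightarrow> 0"
    by (force dest: Lim_transform_eventually)
  then have "(\<lambda>n. \<bar>(-1) ^ Suc n * arc_coeff (Suc n)\<bar>) \<longlonglongrightarrow> 0"
    by (rule tendsto_rabs_zero)
  then have "(\<lambda>n. arc_coeff (Suc n)) \<longlonglongrightarrow> 0"
    by (simp add: abs_mult power_abs tendsto_rabs_zero_iff)
  then show ?thesis by (rule LIMSEQ_imp_Suc)
qed

definition arc_poly :: "nat \<Rightarrow> real \<Rightarrow> real" where
  "arc_poly N s = (\<Sum>k<N. arc_coeff k * s ^ (2 * k + 1))"

lemma DERIV_odd_power:
  "((\<lambda>x. x ^ (2 * k + 1)) has_field_derivative (2 * real k + 1) * x ^ (2 * k)) (at (x :: real))"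
  by (rule DERIV_cong[OF DERIV_pow]) simp

text \<open>The coefficient recurrence makes the equation (1 + s^2) f' = 1 + (2 \<nu> - 1) s f
  telescope on truncations, leaving a single defect term of degree 2 N.\<close>

lemma DERIV_arc_poly:
  "(arc_poly N has_field_derivative
     (1 - (2 * real N + 1) * arc_coeff N * s ^ (2 * N) + (2 * \<nu> - 1) * s * arc_poly N s) / (1 + s\<^sup>2)) (at s)"
proof -
  have ode: "(1 + s\<^sup>2) * (\<Sum>k<N. arc_coeff k * ((2 * real k + 1) * s ^ (2 * k))) =
      1 - (2 * real N + 1) * arc_coeff N * s ^ (2 * N) + (2 * \<nu> - 1) * s * arc_poly N s" for N
  proof (induction N)
    case 0
    then show ?case by (simp add: arc_poly_def arc_coeff_def)
  next
    case (Suc N)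
    have "(2 * real (Suc N) + 1) * arc_coeff (Suc N) * s ^ (2 * Suc N) =
        - (2 * real N + 2 - 2 * \<nu>) * arc_coeff N * s ^ (2 * N) * s\<^sup>2"
      using arc_coeff_Suc[of N] by (simp add: add_ac mult_ac power2_eq_square)
    then show ?case using Suc.IH
      by (simp add: arc_poly_def algebra_simps power2_eq_square)
  qed
  have "(arc_poly N has_field_derivative (\<Sum>k<N. arc_coeff k * ((2 * real k + 1) * s ^ (2 * k)))) (at s)"
    unfolding arc_poly_def[abs_def]
    by (intro DERIV_sum DERIV_cmult DERIV_odd_power)
  moreover have "1 + s\<^sup>2 \<noteq> 0" by (metis add_pos_nonneg less_irrefl zero_le_power2 zero_less_one)
  ultimately show ?thesis by (simp add: ode[symmetric])
qed

text \<open>The solution of the differential equation satisfied by the Poisson integral differs from the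
  partial sum of the Gauss series by a multiple of the first omitted coefficient, uniformly up to
  and including the boundary point \<open>s = 1\<close>.\<close>

lemma poisson_kernel_approx:
  assumes s: "s > 0"
  shows "\<bar>(1 + s\<^sup>2) powr (1 / 2 - \<nu>) * (s * stieltjes \<nu> (s\<^sup>2) + 2 * rGamma \<nu> * arc_poly N s)
      - sqrt pi / Gamma (\<nu> + 1 / 2)\<bar> \<le> 2 * \<bar>rGamma \<nu>\<bar> * \<bar>arc_coeff N\<bar> * s ^ (2 * N + 1)"
proof -
  define L where "L = 2 * \<bar>rGamma \<nu>\<bar> * \<bar>arc_coeff N\<bar>"
  define G where "G s = s * stieltjes \<nu> (s\<^sup>2)" for s
  \<comment> \<open>The power is the integrating factor of the homogeneous equation. The
    inhomogeneous terms of \<open>G\<close> and of the truncation cancel, so \<open>E'\<close>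
    contains only the defect term.\<close>
  define E where "E s = (1 + s\<^sup>2) powr (1 / 2 - \<nu>) * (G s + 2 * rGamma \<nu> * arc_poly N s)" for s
  have pos: "1 + x\<^sup>2 > 0" for x :: real by (simp add: add_pos_nonneg)
  define E' where "E' x = - 2 * rGamma \<nu> * ((2 * real N + 1) * arc_coeff N * x ^ (2 * N)) * (1 + x\<^sup>2) powr (- 1 / 2 - \<nu>)" for x
  have DE: "(E has_field_derivative E' x) (at x)" if "x > 0" for x
  proof -
    have p: "(1 + x\<^sup>2) powr (1 / 2 - \<nu>) = (1 + x\<^sup>2) * (1 + x\<^sup>2) powr (- 1 / 2 - \<nu>)"
      using pos[of x] by (simp add: powr_mult_base)
    have p': "(1 + x\<^sup>2) powr (1 / 2 - \<nu> - 1) = (1 + x\<^sup>2) powr (- 1 / 2 - \<nu>)"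
    proof -
      have "1 / 2 - \<nu> - 1 = - 1 / 2 - \<nu>" by simp
      then show ?thesis by (simp only:)
    qed
    have "((\<lambda>x. (1 + x\<^sup>2) powr (1 / 2 - \<nu>)) has_field_derivative
        (1 / 2 - \<nu>) * (1 + x\<^sup>2) powr (- 1 / 2 - \<nu>) * (2 * x)) (at x)"
      using pos[of x] unfolding p'[symmetric] by (auto intro!: derivative_eq_intros)
    from DERIV_mult[OF this DERIV_add[OF DERIV_poisson_kernel[OF nu that] DERIV_cmult[OF DERIV_arc_poly[of N x], of "2 * rGamma \<nu>"]]]
    show ?thesis
      unfolding E_def[abs_def] G_def
    proof (rule DERIV_cong)
      have "(1 / 2 - \<nu>) * P * (2 * x) * (g + 2 * r * f) +
          (((2 * \<nu> - 1) * x * g - 2 * r) / w + 2 * r * ((1 - M + (2 * \<nu> - 1) * x * f) / w)) * (w * P) =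
          - 2 * r * M * P" if "w \<noteq> 0" for P g r f w M :: real
      proof -
        have "(A / w + 2 * r * (B / w)) * (w * P) = (A + 2 * r * B) * P" for A B
          using that by (simp add: field_simps)
        then show ?thesis by (simp only:) (simp add: algebra_simps)
      qed
      note * = this[of "1 + x\<^sup>2"]
      show "(1 / 2 - \<nu>) * (1 + x\<^sup>2) powr (- 1 / 2 - \<nu>) * (2 * x) * (x * stieltjes \<nu> (x\<^sup>2) + 2 * rGamma \<nu> * arc_poly N x) +
        (((2 * \<nu> - 1) * x * (x * stieltjes \<nu> (x\<^sup>2)) - 2 * rGamma \<nu>) / (1 + x\<^sup>2) +
         2 * rGamma \<nu> * ((1 - (2 * real N + 1) * arc_coeff N * x ^ (2 * N) + (2 * \<nu> - 1) * x * arc_poly N x) / (1 + x\<^sup>2))) *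
        (1 + x\<^sup>2) powr (1 / 2 - \<nu>) = E' x"
        unfolding p E'_def
        by (rule *) (use pos[of x] in simp)
    qed
  qed
  \<comment> \<open>The remaining power has exponent - 1/2 - \<nu> < 0 and base at least 1, so |E'|
    is at most the derivative of L x^(2 N + 1).\<close>
  have E'_le: "\<bar>E' x\<bar> \<le> L * ((2 * real N + 1) * x ^ (2 * N))" if "x > 0" for x
  proof -
    have "(1 + x\<^sup>2) powr (- 1 / 2 - \<nu>) \<le> (1 + x\<^sup>2) powr 0"
      using nu by (intro powr_mono) auto
    then have "(1 + x\<^sup>2) powr (- 1 / 2 - \<nu>) \<le> 1" using pos[of x] by simp
    then have "L * ((2 * real N + 1) * x ^ (2 * N)) * (1 + x\<^sup>2) powr (- 1 / 2 - \<nu>) \<le> L * ((2 * real N + 1) * x ^ (2 * N)) * 1"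
      using that by (intro mult_left_mono) (auto simp: L_def)
    then show ?thesis using that by (simp add: E'_def L_def abs_mult mult_ac)
  qed
  \<comment> \<open>Adding or subtracting L x^(2 N + 1) makes \<open>E\<close> monotone; letting e
    tend to 0 then bounds \<open>E s\<close> without integrating \<open>E'\<close> from the singular
    endpoint.\<close>
  have mono: "E e + L * e ^ (2 * N + 1) \<le> E s + L * s ^ (2 * N + 1)"
    if "0 < e" "e \<le> s" for e
  proof (rule DERIV_nonneg_imp_nondecreasing[OF that(2)])
    fix x assume x: "e \<le> x" "x \<le> s"
    then have "x > 0" using that by simp
    have "((\<lambda>x. E x + L * x ^ (2 * N + 1)) has_field_derivative E' x + L * ((2 * real N + 1) * x ^ (2 * N))) (at x)"
      using \<open>x > 0\<close> by (intro DERIV_add DERIV_cmult DERIV_odd_power DE)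
    moreover have "E' x + L * ((2 * real N + 1) * x ^ (2 * N)) \<ge> 0"
      using E'_le[OF \<open>x > 0\<close>] by simp
    ultimately show "\<exists>y. ((\<lambda>x. E x + L * x ^ (2 * N + 1)) has_real_derivative y) (at x) \<and> 0 \<le> y"
      by blast
  qed
  have anti: "E s - L * s ^ (2 * N + 1) \<le> E e - L * e ^ (2 * N + 1)"
    if "0 < e" "e \<le> s" for e
  proof (rule DERIV_nonpos_imp_nonincreasing[OF that(2)])
    fix x assume x: "e \<le> x" "x \<le> s"
    then have "x > 0" using that by simp
    have "((\<lambda>x. E x - L * x ^ (2 * N + 1)) has_field_derivative E' x - L * ((2 * real N + 1) * x ^ (2 * N))) (at x)"
      using \<open>x > 0\<close> by (intro DERIV_diff DERIV_cmult DERIV_odd_power DE)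
    moreover have "E' x - L * ((2 * real N + 1) * x ^ (2 * N)) \<le> 0"
      using E'_le[OF \<open>x > 0\<close>] by simp
    ultimately show "\<exists>y. ((\<lambda>x. E x - L * x ^ (2 * N + 1)) has_real_derivative y) (at x) \<and> y \<le> 0"
      by blast
  qed
  have G0: "(G \<longlongrightarrow> sqrt pi / Gamma (\<nu> + 1 / 2)) (at_right 0)"
  proof -
    let ?C = "sqrt pi / Gamma (\<nu> + 1 / 2)" and ?I = "rGamma (\<nu> + 1)"
    have "((\<lambda>s. (1 + s\<^sup>2) * G s - s * ?I - ?C) \<longlongrightarrow> 0) (at_right 0)"
    proof (rule Lim_null_comparison)
      show "\<forall>\<^sub>F s in at_right 0. norm ((1 + s\<^sup>2) * G s - s * ?I - ?C) \<le> (2 * \<nu> + 1) * (s * ?I)"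
        using eventually_at_right_less[of "0::real"]
        by eventually_elim (use poisson_kernel_bound[OF nu] in \<open>simp add: G_def\<close>)
      show "((\<lambda>s. (2 * \<nu> + 1) * (s * ?I)) \<longlongrightarrow> 0) (at_right 0)"
        by (auto intro!: tendsto_eq_intros)
    qed
    then have "((\<lambda>s. (((1 + s\<^sup>2) * G s - s * ?I - ?C) + s * ?I + ?C) / (1 + s\<^sup>2)) \<longlongrightarrow> (0 + 0 * ?I + ?C) / (1 + 0\<^sup>2)) (at_right 0)"
      by (intro tendsto_intros) auto
    moreover have "((1 + s\<^sup>2) * G s - s * ?I - ?C + s * ?I + ?C) / (1 + s\<^sup>2) = G s" for s
      using pos[of s] by simp
    ultimately show ?thesis by simp
  qed
  have P0: "(arc_poly N \<longlongrightarrow> 0) (at_right 0)"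
    unfolding arc_poly_def[abs_def] by (auto intro!: tendsto_eq_intros)
  have "((\<lambda>s. (1 + s\<^sup>2) powr (1 / 2 - \<nu>)) \<longlongrightarrow> (1 + 0\<^sup>2) powr (1 / 2 - \<nu>)) (at_right (0::real))"
    by (intro tendsto_intros) auto
  then have E0: "(E \<longlongrightarrow> sqrt pi / Gamma (\<nu> + 1 / 2)) (at_right 0)"
    unfolding E_def[abs_def] by (auto intro!: tendsto_eq_intros G0 P0)
  have ev: "\<forall>\<^sub>F e in at_right 0. 0 < e \<and> e \<le> s"
    using eventually_at_right_real[OF s] by (auto elim!: eventually_mono)
  have "sqrt pi / Gamma (\<nu> + 1 / 2) + L * 0 \<le> E s + L * s ^ (2 * N + 1)"
  proof (rule tendsto_upperbound)
    show "((\<lambda>e. E e + L * e ^ (2 * N + 1)) \<longlongrightarrow> sqrt pi / Gamma (\<nu> + 1 / 2) + L * 0) (at_right 0)"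
      by (auto intro!: tendsto_eq_intros E0)
  qed (use ev mono in \<open>auto elim!: eventually_mono\<close>)
  moreover have "sqrt pi / Gamma (\<nu> + 1 / 2) - L * 0 \<ge> E s - L * s ^ (2 * N + 1)"
  proof (rule tendsto_lowerbound)
    show "((\<lambda>e. E e - L * e ^ (2 * N + 1)) \<longlongrightarrow> sqrt pi / Gamma (\<nu> + 1 / 2) - L * 0) (at_right 0)"
      by (auto intro!: tendsto_eq_intros E0)
  qed (use ev anti in \<open>auto elim!: eventually_mono\<close>)
  ultimately show ?thesis unfolding E_def G_def L_def by (auto simp: abs_le_iff)
qed

text \<open>For s \<le> 1 the error of the truncation is at most a constant times the omitted
  coefficient, which tends to 0; so the partial sums converge even where absolute convergence
  fails.\<close>

lemma poisson_kernel_eq: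
  assumes s: "0 < s" "s \<le> 1"
  shows "s * stieltjes \<nu> (s\<^sup>2) = sqrt pi / Gamma (\<nu> + 1 / 2) * (1 + s\<^sup>2) powr (\<nu> - 1 / 2)
    - 2 * s * rGamma \<nu> * hypergeo_2F1 1 (1 - \<nu>) (3 / 2) (- s\<^sup>2)"
proof -
  define C where "C = sqrt pi / Gamma (\<nu> + 1 / 2)"
  define G where "G = s * stieltjes \<nu> (s\<^sup>2)"
  define K where "K = (1 + s\<^sup>2) powr (1 / 2 - \<nu>)"
  have "1 + s\<^sup>2 > 0" by (simp add: add_pos_nonneg)
  then have K: "K > 0" "(1 + s\<^sup>2) powr (\<nu> - 1 / 2) = 1 / K"
    by (simp_all add: K_def powr_minus_divide[symmetric])
  have "(\<lambda>N. K * (G + 2 * rGamma \<nu> * arc_poly N s) - C) \<longlonglongrightarrow> 0"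
  proof (rule Lim_null_comparison)
    show "(\<lambda>N. 2 * \<bar>rGamma \<nu>\<bar> * \<bar>arc_coeff N\<bar>) \<longlonglongrightarrow> 0"
      by (intro tendsto_mult_right_zero tendsto_rabs_zero arc_coeff_tendsto_0)
    have "2 * \<bar>rGamma \<nu>\<bar> * \<bar>arc_coeff N\<bar> * s ^ (2 * N + 1) \<le> 2 * \<bar>rGamma \<nu>\<bar> * \<bar>arc_coeff N\<bar> * 1" for N
      using s by (intro mult_left_mono power_le_one) auto
    then have "norm (K * (G + 2 * rGamma \<nu> * arc_poly N s) - C) \<le> 2 * \<bar>rGamma \<nu>\<bar> * \<bar>arc_coeff N\<bar>" for N
      using poisson_kernel_approx[OF s(1), of N] unfolding C_def G_def K_def real_norm_def
      by (smt (verit, best))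
    then show "\<forall>\<^sub>F N in sequentially. norm (K * (G + 2 * rGamma \<nu> * arc_poly N s) - C) \<le> 2 * \<bar>rGamma \<nu>\<bar> * \<bar>arc_coeff N\<bar>"
      by simp
  qed
  then have "(\<lambda>N. ((K * (G + 2 * rGamma \<nu> * arc_poly N s) - C) + C) / K - G) \<longlonglongrightarrow> (0 + C) / K - G"
    using K by (intro tendsto_intros) auto
  then have lim: "(\<lambda>N. 2 * rGamma \<nu> * arc_poly N s) \<longlonglongrightarrow> C / K - G"
    using K by simp
  have "2 * s * rGamma \<nu> * hypergeo_2F1 1 (1 - \<nu>) (3 / 2) (- s\<^sup>2) = C / K - G"
  \<comment> \<open>Convergence of the Gauss series is read off after dividing by
    \<open>rGamma \<nu>\<close>; if that is 0, both sides vanish.\<close>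
  proof (cases "rGamma \<nu> = 0")
    case True
    then show ?thesis using lim by (simp add: LIMSEQ_const_iff)
  next
    case False
    define h where "h k = fps_nth (fps_hypergeo [1, 1 - \<nu>] [3 / 2] 1) k * (- s\<^sup>2) ^ k" for k
    have h: "arc_coeff k * s ^ (2 * k + 1) = s * h k" for k
      by (simp add: h_def arc_coeff_def pochhammer_fact[symmetric] power_minus[of "s\<^sup>2"] power_mult)
    have "(\<lambda>N. 2 * rGamma \<nu> * arc_poly N s / (2 * rGamma \<nu> * s)) \<longlonglongrightarrow> (C / K - G) / (2 * rGamma \<nu> * s)"
      using False s by (intro tendsto_intros lim) auto
    then have "h sums ((C / K - G) / (2 * rGamma \<nu> * s))"
      unfolding sums_def arc_poly_def h sum_distrib_left[symmetric] using False s by simp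
    then have "hypergeo_2F1 1 (1 - \<nu>) (3 / 2) (- s\<^sup>2) = (C / K - G) / (2 * rGamma \<nu> * s)"
      unfolding hypergeo_2F1_def eval_fps_def h_def by (simp add: sums_iff)
    then show ?thesis using False s by simp
  qed
  then show ?thesis unfolding K(2) C_def[symmetric] G_def[symmetric] by simp
qed

end

section \<open>The coefficients\<close>

text \<open>Applied over the complex numbers, with z imaginary, to extract real parts, and over the
  reals to measure antidiagonal sums.\<close>

lemma binomial_even_part:
  fixes y z :: "'a :: comm_ring_1"
  shows "(y + z) ^ (2 * N + 1) + (y - z) ^ (2 * N + 1) =
    2 * (\<Sum>n\<le>N. of_nat ((2 * N + 1) choose (2 * n)) * z ^ (2 * n) * y ^ (2 * (N - n) + 1))"
proof -
  have pairs: "(\<Sum>i\<le>2 * N + 1. g i) = (\<Sum>n\<le>N. g (2 * n) + g (2 * n + 1))" for g :: "nat \<Rightarrow> 'a" and N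
    by (induction N) (simp_all add: algebra_simps)
  let ?g = "\<lambda>i. of_nat ((2 * N + 1) choose i) * (z ^ i + (- z) ^ i) * y ^ (2 * N + 1 - i)"
  have "(z + y) ^ (2 * N + 1) + (- z + y) ^ (2 * N + 1) = (\<Sum>i\<le>2 * N + 1. ?g i)"
    unfolding binomial_ring sum.distrib[symmetric] by (simp add: algebra_simps)
  also have "\<dots> = (\<Sum>n\<le>N. ?g (2 * n) + ?g (2 * n + 1))" by (rule pairs)
  also have "\<dots> = 2 * (\<Sum>n\<le>N. of_nat ((2 * N + 1) choose (2 * n)) * z ^ (2 * n) * y ^ (2 * (N - n) + 1))"
    unfolding sum_distrib_left
  proof (rule sum.cong[OF refl])
    fix n assume "n \<in> {..N}"
    then have "2 * N + 1 - 2 * n = 2 * (N - n) + 1" by auto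
    then show "?g (2 * n) + ?g (2 * n + 1) =
      2 * (of_nat ((2 * N + 1) choose (2 * n)) * z ^ (2 * n) * y ^ (2 * (N - n) + 1))"
      by (simp only:) (simp add: algebra_simps)
  qed
  finally show ?thesis by (simp add: add.commute)
qed

lemma fact_odd_Gamma: "fact (2 * n + 1) = (2 * 4 ^ n * fact n * Gamma (real n + 3 / 2) / sqrt pi :: real)"
proof -
  have "Gamma ((real n + 1 / 2) + 1) = (real n + 1 / 2) * Gamma (real n + 1 / 2)"
    by (rule Gamma_plus1) (auto dest: nonpos_Ints_nonpos)
  then have G: "Gamma (real n + 3 / 2) = (real n + 1 / 2) * Gamma (real n + 1 / 2)"
    by (simp add: add.commute)
  have "fact (2 * n + 1) = (2 * real n + 1) * fact (2 * n)" by (simp add: algebra_simps)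
  then show ?thesis unfolding fact_double_Gamma G by (simp add: algebra_simps)
qed

context
  fixes \<nu> :: real
  assumes nu: "\<nu> > - 1 / 2"
begin

text \<open>Duplication applied to the three factorials of the binomial coefficient; the powers of 4
  cancel, and the moment absorbs the remaining sqrt pi and Gamma (n + 1/2).\<close>

lemma coeff_A_eq:
  "coeff_A \<nu> k n = real ((2 * (k + n) + 1) choose (2 * n)) * poisson_moment \<nu> n * Riemann_zeta (2 * real (k + n) + 2)"
proof -
  define g h j l where "g = Gamma (real (k + n) + 3 / 2)" and "h = Gamma (real k + 3 / 2)"
    and "j = Gamma (real n + 1 / 2)" and "l = Gamma (real n + \<nu> + 1)"
  have pos: "g > 0" "h > 0" "j > 0" "l > 0"
    unfolding g_def h_def j_def l_def using nu by (auto intro!: Gamma_real_pos)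
  have "real ((2 * (k + n) + 1) choose (2 * n)) = fact (2 * (k + n) + 1) / (fact (2 * n) * fact (2 * k + 1))"
    by (subst binomial_fact) auto
  also have "\<dots> = (2 * 4 ^ (k + n) * fact (k + n) * g / sqrt pi) / ((4 ^ n * fact n * j / sqrt pi) * (2 * 4 ^ k * fact k * h / sqrt pi))"
    unfolding fact_odd_Gamma fact_double_Gamma g_def h_def j_def by simp
  also have "\<dots> * poisson_moment \<nu> n = fact (k + n) * g / (fact k * fact n * h * l)"
    unfolding poisson_moment_def j_def[symmetric] l_def[symmetric] using pos
    by (simp add: power_add divide_simps) (simp add: algebra_simps)?
  also have "fact (k + n) = Gamma (real k + real n + 1)"
    using Gamma_fact[of "k + n", where 'a = real] by (simp add: add_ac)
  finally show ?thesis
    by (simp add: coeff_A_def g_def h_def l_def add_ac distrib_left)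
qed

lemma coeff_A_nonneg: "coeff_A \<nu> k n \<ge> 0"
  unfolding coeff_A_eq
  by (intro mult_nonneg_nonneg of_nat_0_le_iff less_imp_le[OF poisson_moment_pos[OF nu]]
      order_trans[OF zero_le_one Riemann_zeta_even_bounds(1)])

lemma coeff_A_le:
  "coeff_A \<nu> k n \<le> rGamma (\<nu> + 1) * Riemann_zeta 2 * real ((2 * (k + n) + 1) choose (2 * n))"
proof -
  have "poisson_moment \<nu> n * Riemann_zeta (2 * real (k + n) + 2) \<le> rGamma (\<nu> + 1) * Riemann_zeta 2"
    using poisson_moment_pos[OF nu, of n] poisson_moment_le[OF nu, of n] Riemann_zeta_even_bounds[of "k + n"]
    by (intro mult_mono) auto
  from mult_left_mono[OF this, of "real ((2 * (k + n) + 1) choose (2 * n))"]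
  show ?thesis by (simp add: coeff_A_eq mult_ac)
qed

text \<open>Moments and zeta values are bounded, so the N-th antidiagonal is at most a constant
  times the even part of a binomial power, hence times (x + y)^(2 N + 1).\<close>

lemma coeff_A_abs_summable:
  assumes "0 < x" "0 < y" "x + y < 1"
  shows "(\<lambda>(k, n). norm ((-1) ^ k * (coeff_A \<nu> k n * x ^ (2 * n)) * y ^ (2 * k + 1))) summable_on UNIV"
proof (rule abs_summable_diagonal)
  define K where "K = rGamma (\<nu> + 1) * Riemann_zeta 2"
  have K: "K \<ge> 0"
    using poisson_moment_pos[OF nu, of 0] poisson_moment_le[OF nu, of 0] Riemann_zeta_even_bounds(1)[of 0]
    by (simp add: K_def)
  show "summable (\<lambda>N. \<Sum>n\<le>N. norm ((-1) ^ (N - n) * (coeff_A \<nu> (N - n) n * x ^ (2 * n)) * y ^ (2 * (N - n) + 1)))"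
  proof (rule summable_comparison_test'[where N = 0])
    show "summable (\<lambda>N. K * (x + y) * ((x + y)\<^sup>2) ^ N)"
      using assms by (intro summable_mult summable_geometric) (simp add: power_less_one_iff abs_square_less_1)
    fix N
    have "(\<Sum>n\<le>N. norm ((-1) ^ (N - n) * (coeff_A \<nu> (N - n) n * x ^ (2 * n)) * y ^ (2 * (N - n) + 1))) \<le>
        (\<Sum>n\<le>N. K * (real ((2 * N + 1) choose (2 * n)) * x ^ (2 * n) * y ^ (2 * (N - n) + 1)))"
    proof (rule sum_mono)
      fix n assume n: "n \<in> {..N}"
      then have Nn: "N - n + n = N" by simp
      have "norm ((-1) ^ (N - n) * (coeff_A \<nu> (N - n) n * x ^ (2 * n)) * y ^ (2 * (N - n) + 1)) =
          coeff_A \<nu> (N - n) n * (x ^ (2 * n) * y ^ (2 * (N - n) + 1))"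
        using assms coeff_A_nonneg[of "N - n" n] by (simp add: abs_mult power_abs)
      also have "\<dots> \<le> K * real ((2 * N + 1) choose (2 * n)) * (x ^ (2 * n) * y ^ (2 * (N - n) + 1))"
        using coeff_A_le[of "N - n" n, unfolded Nn] assms by (intro mult_right_mono) (auto simp: K_def)
      finally show "norm ((-1) ^ (N - n) * (coeff_A \<nu> (N - n) n * x ^ (2 * n)) * y ^ (2 * (N - n) + 1)) \<le>
          K * (real ((2 * N + 1) choose (2 * n)) * x ^ (2 * n) * y ^ (2 * (N - n) + 1))"
        by (simp only: mult.assoc)
    qed
    also have "\<dots> = K * (((y + x) ^ (2 * N + 1) + (y - x) ^ (2 * N + 1)) / 2)"
      unfolding binomial_even_part sum_distrib_left[symmetric] by simp
    also have "\<dots> \<le> K * (x + y) ^ (2 * N + 1)"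
    proof (rule mult_left_mono[OF _ K])
      have "(y - x) ^ (2 * N + 1) \<le> \<bar>y - x\<bar> ^ (2 * N + 1)" by (simp only: power_abs[symmetric] abs_ge_self)
      also have "\<dots> \<le> (x + y) ^ (2 * N + 1)" using assms by (intro power_mono) auto
      finally show "((y + x) ^ (2 * N + 1) + (y - x) ^ (2 * N + 1)) / 2 \<le> (x + y) ^ (2 * N + 1)"
        by (simp add: add.commute)
    qed
    finally show "norm (\<Sum>n\<le>N. norm ((-1) ^ (N - n) * (coeff_A \<nu> (N - n) n * x ^ (2 * n)) * y ^ (2 * (N - n) + 1))) \<le>
        K * (x + y) * ((x + y)\<^sup>2) ^ N"
      by (simp add: sum_nonneg power_mult[symmetric] mult_ac)
  qed
qed

text \<open>Rows of an absolutely summable double series converge; the auxiliary y only has to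
  satisfy x + y < 1 and is divided out again.\<close>

lemma coeff_C_summable:
  assumes "0 < x" "x < 1"
  shows "summable (\<lambda>n. coeff_A \<nu> k n * x ^ (2 * n))"
proof -
  define y where "y = (1 - x) / 2"
  have y: "0 < y" "x + y < 1" using assms by (auto simp: y_def field_simps)
  have "summable (\<lambda>n. (-1) ^ k * (coeff_A \<nu> k n * x ^ (2 * n)) * y ^ (2 * k + 1))"
    by (rule double_series_rows(1)[OF coeff_A_abs_summable[OF assms(1) y]])
  then have "summable (\<lambda>n. (-1) ^ k * (coeff_A \<nu> k n * x ^ (2 * n)) * y ^ (2 * k + 1) * ((-1) ^ k / y ^ (2 * k + 1)))"
    by (rule summable_mult2)
  then show ?thesis using y by (simp add: mult_ac flip: power_add mult_2)
qed

section \<open>The series over k\<close>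

context
  fixes b :: real
  assumes b: "0 < b" "b < 2 * pi"
begin

lemma coeff_C_row:
  "(\<Sum>n. (-1) ^ k * (coeff_A \<nu> k n * (b / (2 * pi)) ^ (2 * n)) * y ^ (2 * k + 1)) = (-1) ^ k * coeff_C b \<nu> k * y ^ (2 * k + 1)"
proof -
  have "summable (\<lambda>n. coeff_A \<nu> k n * (b / (2 * pi)) ^ (2 * n))"
    using b by (intro coeff_C_summable) auto
  from sums_mult2[OF sums_mult[OF summable_sums[OF this]], of "(-1) ^ k" "y ^ (2 * k + 1)"]
  show ?thesis by (simp add: coeff_C_def sums_iff del: power_Suc power_add)
qed

lemma coeff_C_ge:
  "coeff_A \<nu> k n * (b / (2 * pi)) ^ (2 * n) \<le> coeff_C b \<nu> k"
proof -
  have "sum (\<lambda>n. coeff_A \<nu> k n * (b / (2 * pi)) ^ (2 * n)) {n} \<le> coeff_C b \<nu> k"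
    unfolding coeff_C_def using b coeff_A_nonneg
    by (intro sum_le_suminf coeff_C_summable) auto
  then show ?thesis by simp
qed

lemma coeff_C_nonneg: "coeff_C b \<nu> k \<ge> 0"
proof -
  have "0 \<le> coeff_A \<nu> k 0 * (b / (2 * pi)) ^ (2 * 0)" using coeff_A_nonneg by simp
  also have "\<dots> \<le> coeff_C b \<nu> k" by (rule coeff_C_ge)
  finally show ?thesis .
qed

text \<open>The unsigned version supplies the remainder estimate in the asymptotic
  statement.\<close>

lemma coeff_C_series_summable:
  assumes "0 < a" "a + b < 2 * pi"
  shows "summable (\<lambda>k. (-1) ^ k * coeff_C b \<nu> k * (a / (2 * pi)) ^ (2 * k + 1))"
    and "summable (\<lambda>k. coeff_C b \<nu> k * (a / (2 * pi)) ^ (2 * k + 1))"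
proof -
  define x y where "x = b / (2 * pi)" and "y = a / (2 * pi)"
  have xy: "0 < x" "0 < y" "x + y < 1" using b assms by (auto simp: x_def y_def field_simps)
  define f where "f k n = (-1) ^ k * (coeff_A \<nu> k n * x ^ (2 * n)) * y ^ (2 * k + 1)" for k n
  have abs: "(\<lambda>(k, n). norm (f k n)) summable_on UNIV"
    unfolding f_def by (rule coeff_A_abs_summable[OF xy])
  have "summable (\<lambda>k. \<Sum>n. f k n)"
    using double_series_rows(2)[OF abs] by (rule sums_summable)
  then show "summable (\<lambda>k. (-1) ^ k * coeff_C b \<nu> k * (a / (2 * pi)) ^ (2 * k + 1))"
    unfolding f_def x_def coeff_C_row y_def .
  have "(\<lambda>(k, n). norm (norm (f k n))) summable_on UNIV" using abs by simp
  from double_series_rows(2)[OF this] have "summable (\<lambda>k. \<Sum>n. norm (f k n))"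
    by (rule sums_summable)
  \<comment> \<open>All coefficients are nonnegative, so (-1)^k undoes the sign of the whole
    row.\<close>
  moreover have "norm (f k n) = (-1) ^ k * ((-1) ^ k * (coeff_A \<nu> k n * x ^ (2 * n)) * y ^ (2 * k + 1))" for k n
    using xy coeff_A_nonneg[of k n] by (simp add: f_def abs_mult power_abs flip: power_add mult_2 mult.assoc)
  moreover have "(\<Sum>n. (-1) ^ k * ((-1) ^ k * (coeff_A \<nu> k n * x ^ (2 * n)) * y ^ (2 * k + 1))) =
      coeff_C b \<nu> k * y ^ (2 * k + 1)" for k
    unfolding suminf_mult[OF double_series_rows(1)[OF abs, unfolded f_def]]
    unfolding x_def coeff_C_row by (simp flip: power_add mult_2 mult.assoc)
  ultimately show "summable (\<lambda>k. coeff_C b \<nu> k * (a / (2 * pi)) ^ (2 * k + 1))"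
    by (simp add: y_def)
qed

text \<open>The moments decay more slowly than any geometric sequence, so the diagonal sums of the double
  series are almost as large as those of the even part of a binomial expansion, and the series over
  \<open>k\<close> cannot converge beyond \<open>a + b = 2 * pi\<close>.\<close>

lemma coeff_C_series_summableD:
  assumes a: "0 < a" and sum: "summable (\<lambda>k. (-1) ^ k * coeff_C b \<nu> k * (a / (2 * pi)) ^ (2 * k + 1))"
  shows "a + b \<le> 2 * pi"
proof (rule ccontr)
  assume "\<not> a + b \<le> 2 * pi"
  define x y where "x = b / (2 * pi)" and "y = a / (2 * pi)"
  have xy: "0 < x" "x < 1" "0 < y" "x + y > 1"
    using b a \<open>\<not> a + b \<le> 2 * pi\<close> by (auto simp: x_def y_def field_simps)
  \<comment> \<open>There is room for a loss factor \<rho> < 1 with \<rho> x + y still above 1; it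
    is used squared because moment n accompanies x^(2 n).\<close>
  have "max 0 ((1 - y) / x) < 1" using xy by (simp add: field_simps)
  then obtain \<rho> where \<rho>: "max 0 ((1 - y) / x) < \<rho>" "\<rho> < 1" using dense by blast
  then have \<rho>0: "\<rho> > 0" "\<rho> * x + y > 1" using xy by (auto simp: field_simps)
  have "0 < \<rho>\<^sup>2" "\<rho>\<^sup>2 < 1" using \<rho> \<rho>0 by (auto simp: power_less_one_iff abs_square_less_1)
  then obtain \<kappa> where \<kappa>: "\<kappa> > 0" "\<And>n. poisson_moment \<nu> n \<ge> \<kappa> * (\<rho>\<^sup>2) ^ n"
    using poisson_moment_lower_bound[OF nu] by blast
  obtain B where B: "\<And>k. coeff_C b \<nu> k * y ^ (2 * k + 1) \<le> B"
  proof -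
    have "Bseq (\<lambda>k. (-1) ^ k * coeff_C b \<nu> k * (a / (2 * pi)) ^ (2 * k + 1))"
      by (rule convergent_imp_Bseq[OF convergentI[OF summable_LIMSEQ_zero[OF sum]]])
    then obtain B where B: "\<And>k. norm ((-1) ^ k * coeff_C b \<nu> k * (a / (2 * pi)) ^ (2 * k + 1)) \<le> B"
      by (auto simp: Bseq_def)
    have "coeff_C b \<nu> k * y ^ (2 * k + 1) \<le> B" for k
      using B[of k] a coeff_C_nonneg[of k] by (simp add: abs_mult power_abs y_def)
    then show ?thesis using that by blast
  qed
  define p q where "p = y + \<rho> * x" and "q = \<bar>y - \<rho> * x\<bar>"
  have "\<rho> * x > 0" using \<rho>0 xy by simp
  then have pq: "p > 1" "0 \<le> q" "q < p" unfolding p_def q_def using \<rho>0 xy by linarith+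
  \<comment> \<open>The N-th antidiagonal exceeds a multiple of p^(2 N), yet consists of N + 1
    terms, each at most B; for p > 1 this cannot hold for all N.\<close>
  have main: "\<kappa> * (p - q) / 2 * (p\<^sup>2) ^ N \<le> real (Suc N) * B" for N
  proof -
    have "\<kappa> * (p - q) / 2 * (p\<^sup>2) ^ N = \<kappa> * ((p - q) * p ^ (2 * N)) / 2"
      by (simp add: power_mult)
    also have "\<dots> \<le> \<kappa> * (p ^ (2 * N + 1) + (y - \<rho> * x) ^ (2 * N + 1)) / 2"
    proof -
      have "q * q ^ (2 * N) \<le> q * p ^ (2 * N)" using pq by (intro mult_left_mono power_mono) auto
      moreover have "- ((y - \<rho> * x) ^ (2 * N + 1)) \<le> q ^ (2 * N + 1)"
        unfolding q_def by (simp only: power_abs[symmetric] abs_ge_minus_self)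
      ultimately have "(p - q) * p ^ (2 * N) \<le> p ^ (2 * N + 1) + (y - \<rho> * x) ^ (2 * N + 1)"
        by (simp add: algebra_simps)
      then show ?thesis using \<kappa>(1) by (intro divide_right_mono mult_left_mono) auto
    qed
    also have "\<dots> = (\<Sum>n\<le>N. real ((2 * N + 1) choose (2 * n)) * (\<kappa> * (\<rho>\<^sup>2) ^ n) * (x ^ (2 * n) * y ^ (2 * (N - n) + 1)))"
      unfolding p_def binomial_even_part
      by (simp add: sum_distrib_left power_mult_distrib power_mult[symmetric] mult_ac)
    also have "\<dots> \<le> (\<Sum>n\<le>N. coeff_C b \<nu> (N - n) * y ^ (2 * (N - n) + 1))"
    proof (rule sum_mono)
      fix n assume n: "n \<in> {..N}"
      have "real ((2 * N + 1) choose (2 * n)) * (\<kappa> * (\<rho>\<^sup>2) ^ n) * 1 \<le>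
          real ((2 * N + 1) choose (2 * n)) * poisson_moment \<nu> n * Riemann_zeta (2 * real N + 2)"
        using \<kappa> \<rho>0 poisson_moment_pos[OF nu, of n] Riemann_zeta_even_bounds(1)[of N]
        by (intro mult_mono) auto
      also have "\<dots> = coeff_A \<nu> (N - n) n" using n by (simp add: coeff_A_eq)
      finally have "real ((2 * N + 1) choose (2 * n)) * (\<kappa> * (\<rho>\<^sup>2) ^ n) * (x ^ (2 * n) * y ^ (2 * (N - n) + 1)) \<le>
          coeff_A \<nu> (N - n) n * (x ^ (2 * n) * y ^ (2 * (N - n) + 1))"
        using xy by (intro mult_right_mono) auto
      also have "\<dots> \<le> coeff_C b \<nu> (N - n) * y ^ (2 * (N - n) + 1)"
        using coeff_C_ge[of "N - n" n] xy unfolding x_def[symmetric] mult.assoc[symmetric]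
        by (intro mult_right_mono) auto
      finally show "real ((2 * N + 1) choose (2 * n)) * (\<kappa> * (\<rho>\<^sup>2) ^ n) * (x ^ (2 * n) * y ^ (2 * (N - n) + 1)) \<le>
          coeff_C b \<nu> (N - n) * y ^ (2 * (N - n) + 1)" .
    qed
    also have "\<dots> \<le> (\<Sum>n\<le>N. B)" by (intro sum_mono B)
    finally show ?thesis by simp
  qed
  \<comment> \<open>Dividing by p^(2 N) bounds a positive constant by a sequence tending to
    0.\<close>
  define z where "z = 1 / p\<^sup>2"
  have "p\<^sup>2 > 1" using pq by (simp add: one_less_power)
  then have z: "0 < z" "z < 1" by (auto simp: z_def divide_less_eq_1)
  have "norm z < 1" using z by simp
  then have lim: "(\<lambda>N. (of_nat N * z ^ N + z ^ N) * B) \<longlonglongrightarrow> (0 + 0) * B"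
    by (rule tendsto_mult[OF tendsto_add[OF powser_times_n_limit_0 LIMSEQ_power_zero] tendsto_const])
       (use \<open>norm z < 1\<close> in simp)
  have "\<kappa> * (p - q) / 2 \<le> (0 + 0) * B"
  proof (rule LIMSEQ_le_const[OF lim], intro exI allI impI)
    fix N
    have "\<kappa> * (p - q) / 2 * (p\<^sup>2) ^ N * z ^ N \<le> real (Suc N) * B * z ^ N"
      using main z by (intro mult_right_mono) auto
    moreover have "(p\<^sup>2) ^ N * z ^ N = 1" using pq by (simp add: z_def power_divide)
    ultimately have "\<kappa> * (p - q) / 2 \<le> real (Suc N) * B * z ^ N"
      by (simp only: mult.assoc mult_1_right)
    also have "\<dots> = (of_nat N * z ^ N + z ^ N) * B" by (simp add: algebra_simps)
    finally show "\<kappa> * (p - q) / 2 \<le> (of_nat N * z ^ N + z ^ N) * B" .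
  qed
  moreover have "0 < \<kappa> * (p - q) / 2" using \<kappa>(1) pq by simp
  ultimately show False by simp
qed

end
end

section \<open>Summation over n\<close>

text \<open>The argument \<open>a\<close> comes last so that the partial application is the function
  whose continuity and asymptotics are studied.\<close>

definition Bessel_sum :: "real \<Rightarrow> real \<Rightarrow> real \<Rightarrow> real" where
  "Bessel_sum b \<nu> a = (\<Sum>n. exp (- a * real (Suc n)) / (b * real (Suc n) / 2) powr \<nu> *
     Bessel_J \<nu> (b * real (Suc n)))"

definition Bessel_main_term :: "real \<Rightarrow> real \<Rightarrow> real \<Rightarrow> real" where
  "Bessel_main_term b \<nu> a = sqrt pi / (b * Gamma (\<nu> + 1 / 2)) * (1 + a\<^sup>2 / b\<^sup>2) powr (\<nu> - 1 / 2)
     - 1 / (2 * Gamma (1 + \<nu>))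
     - 2 * a / b\<^sup>2 * rGamma \<nu> * hypergeo_2F1 1 (1 - \<nu>) (3 / 2) (- (a\<^sup>2 / b\<^sup>2))"

context
  fixes \<nu> b :: real
  assumes nu: "\<nu> > - 1 / 2" and b0: "b > 0"
begin

lemma Bessel_term_eq:
  "exp (- a * real (Suc n)) / (b * real (Suc n) / 2) powr \<nu> * Bessel_J \<nu> (b * real (Suc n)) =
    (\<integral>u. cos (b * real (Suc n) * sqrt u) \<partial>poisson_measure \<nu>) * exp (- a) ^ Suc n"
proof -
  have 1: "exp (- a * real (Suc n)) = exp (- a) ^ Suc n"
    by (simp only: exp_of_nat_mult[symmetric] mult.commute)
  have 2: "Bessel_J \<nu> (b * real (Suc n)) / (b * real (Suc n) / 2) powr \<nu> =
      (\<integral>u. cos (b * real (Suc n) * sqrt u) \<partial>poisson_measure \<nu>)"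
    using b0 by (intro Bessel_J_div_powr[OF nu]) (simp del: of_nat_Suc)
  show ?thesis unfolding 1 2[symmetric] by simp
qed

lemma cos_integral_bound: "\<bar>\<integral>u. cos (x * sqrt u) \<partial>poisson_measure \<nu>\<bar> \<le> rGamma (\<nu> + 1)"
  using poisson_integral_bound[OF nu, of "\<lambda>u. cos (x * sqrt u)" 1] by simp

lemma cos_integral_powser_summable:
  assumes "\<bar>q\<bar> < 1"
  shows "summable (\<lambda>n. (\<integral>u. cos (b * real (Suc n) * sqrt u) \<partial>poisson_measure \<nu>) * q ^ n)"
proof (rule summable_comparison_test'[where N = 0])
  show "summable (\<lambda>n. rGamma (\<nu> + 1) * \<bar>q\<bar> ^ n)"
    using assms by (intro summable_mult summable_geometric) simp
  show "norm ((\<integral>u. cos (b * real (Suc n) * sqrt u) \<partial>poisson_measure \<nu>) * q ^ n) \<le> rGamma (\<nu> + 1) * \<bar>q\<bar> ^ n" for n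
    unfolding real_norm_def abs_mult power_abs by (intro mult_right_mono cos_integral_bound) simp
qed

lemma Bessel_summable:
  assumes "a > 0"
  shows "summable (\<lambda>n. exp (- a * real (Suc n)) / (b * real (Suc n) / 2) powr \<nu> * Bessel_J \<nu> (b * real (Suc n)))"
  unfolding Bessel_term_eq power_Suc2 mult.assoc[symmetric]
  using assms by (intro summable_mult2 cos_integral_powser_summable) simp

lemma Bessel_sum_eq:
  assumes "a > 0"
  shows "Bessel_sum b \<nu> a =
    (\<Sum>n. (\<integral>u. cos (b * real (Suc n) * sqrt u) \<partial>poisson_measure \<nu>) * exp (- a) ^ n) * exp (- a)"
  unfolding Bessel_sum_def Bessel_term_eq power_Suc2 mult.assoc[symmetric]
  using assms by (intro suminf_mult2[symmetric] cos_integral_powser_summable) simp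

text \<open>In q = exp (-a) the sum is a power series with bounded coefficients, times q; K is
  chosen between exp (-a) and 1, inside its disc of convergence.\<close>

lemma isCont_Bessel_sum:
  assumes "a > 0"
  shows "isCont (Bessel_sum b \<nu>) a"
proof -
  define c where "c n = (\<integral>u. cos (b * real (Suc n) * sqrt u) \<partial>poisson_measure \<nu>)" for n
  define K where "K = (1 + exp (- a)) / 2"
  have K: "0 < K" "exp (- a) < K" "K < 1" using assms by (auto simp: K_def add_pos_pos)
  have "isCont (\<lambda>q. \<Sum>n. c n * q ^ n) (exp (- a))"
  proof (rule isCont_powser)
    show "summable (\<lambda>n. c n * K ^ n)"
      unfolding c_def using K by (intro cos_integral_powser_summable) (auto simp: abs_if)
    show "norm (exp (- a)) < norm K" using K by simp
  qed
  then have "isCont (\<lambda>a. (\<Sum>n. c n * exp (- a) ^ n) * exp (- a)) a"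
    by (intro isCont_mult isCont_o2[of _ "\<lambda>a. exp (- a)" "\<lambda>q. \<Sum>n. c n * q ^ n"] continuous_intros) auto
  moreover have "\<forall>\<^sub>F x in nhds a. Bessel_sum b \<nu> x = (\<Sum>n. c n * exp (- x) ^ n) * exp (- x)"
    using eventually_nhds_in_open[of "{0<..}" a] assms
    by (auto elim!: eventually_mono simp: Bessel_sum_eq c_def)
  ultimately show ?thesis by (simp add: isCont_cong)
qed

text \<open>The hypothesis a \<le> b puts s = a / b into the range where the Gauss series has been
  summed.\<close>

lemma Bessel_main_term_eq:
  assumes a: "0 < a" "a \<le> b"
  shows "Bessel_main_term b \<nu> a = a / b * stieltjes \<nu> ((a / b)\<^sup>2) / b - rGamma (\<nu> + 1) / 2"
proof -
  have "0 < a / b" "a / b \<le> 1" using a b0 by auto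
  from poisson_kernel_eq[OF nu this] have "a / b * stieltjes \<nu> ((a / b)\<^sup>2) / b =
    (sqrt pi / Gamma (\<nu> + 1 / 2) * (1 + (a / b)\<^sup>2) powr (\<nu> - 1 / 2)
    - 2 * (a / b) * rGamma \<nu> * hypergeo_2F1 1 (1 - \<nu>) (3 / 2) (- (a / b)\<^sup>2)) / b"
    by simp
  also have "\<dots> = sqrt pi / (b * Gamma (\<nu> + 1 / 2)) * (1 + (a / b)\<^sup>2) powr (\<nu> - 1 / 2)
    - 2 * a / b\<^sup>2 * rGamma \<nu> * hypergeo_2F1 1 (1 - \<nu>) (3 / 2) (- (a / b)\<^sup>2)"
    by (simp add: diff_divide_distrib power2_eq_square mult_ac)
  finally show ?thesis
    by (simp add: Bessel_main_term_def power_divide rGamma_inverse_Gamma inverse_eq_divide add.commute)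
qed

lemma poisson_integral_lorentz:
  assumes a: "0 < a"
  shows "integrable (poisson_measure \<nu>) (\<lambda>u. a / (a\<^sup>2 + b\<^sup>2 * u))"
    and "(\<integral>u. a / (a\<^sup>2 + b\<^sup>2 * u) \<partial>poisson_measure \<nu>) = a / b * stieltjes \<nu> ((a / b)\<^sup>2) / b"
proof -
  have eq: "a / (a\<^sup>2 + b\<^sup>2 * u) = a / b\<^sup>2 * (1 / ((a / b)\<^sup>2 + u))" for u
    using b0 by (simp add: power_divide add_divide_distrib[symmetric] divide_simps mult.commute)
  have "(a / b)\<^sup>2 > 0" using a b0 by simp
  from integrable_stieltjes(1)[OF nu this]
  show "integrable (poisson_measure \<nu>) (\<lambda>u. a / (a\<^sup>2 + b\<^sup>2 * u))"
    unfolding eq by (rule integrable_mult_right)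
  show "(\<integral>u. a / (a\<^sup>2 + b\<^sup>2 * u) \<partial>poisson_measure \<nu>) = a / b * stieltjes \<nu> ((a / b)\<^sup>2) / b"
    unfolding eq integral_mult_right_zero stieltjes_def[OF nu] by (simp add: power2_eq_square)
qed

text \<open>The real part of the exponential expansion at w = a + i b sqrt u is integrated in u, and
  the resulting antidiagonal sums are regrouped into rows.\<close>

lemma Bessel_sum_expansion:
  assumes a: "0 < a" "a + b < 2 * pi"
  shows "Bessel_sum b \<nu> a = a / b * stieltjes \<nu> ((a / b)\<^sup>2) / b - rGamma (\<nu> + 1) / 2
    + 1 / pi * (\<Sum>k. (-1) ^ k * coeff_C b \<nu> k * (a / (2 * pi)) ^ (2 * k + 1))"
proof -
  define x y where "x = b / (2 * pi)" and "y = a / (2 * pi)"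
  have xy: "0 < x" "0 < y" "x + y < 1" using b0 a by (auto simp: x_def y_def field_simps)
  have b: "0 < b" "b < 2 * pi" using b0 a by auto
  let ?M = "poisson_measure \<nu>"
  define w where "w u = Complex a (b * sqrt u)" for u
  define g where "g u = (\<Sum>n. exp (- a) ^ Suc n * cos (b * real (Suc n) * sqrt u))" for u
  define h where "h u = pi * (g u - a / (a\<^sup>2 + b\<^sup>2 * u) + 1 / 2)" for u
  \<comment> \<open>The k-th term as a polynomial in u, ready for integration by moments; for 0 < u
    < 1 it is the real part of the term in w.\<close>
  define F where "F k u = (-1) ^ k * Riemann_zeta (2 * real k + 2) *
    (\<Sum>n\<le>k. real ((2 * k + 1) choose (2 * n)) * ((-1) ^ n * x ^ (2 * n) * u ^ n) * y ^ (2 * (k - n) + 1))" for k u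
  define f where "f k n = (-1) ^ k * (coeff_A \<nu> k n * x ^ (2 * n)) * y ^ (2 * k + 1)" for k n
  have g_meas [measurable]: "g \<in> borel_measurable borel" unfolding g_def[abs_def] by measurable
  have g_sums: "(\<lambda>n. exp (- a) ^ Suc n * cos (b * real (Suc n) * sqrt u)) sums g u" for u
    unfolding g_def
  proof (rule summable_sums, rule summable_comparison_test'[where N = 0])
    show "summable (\<lambda>n. exp (- a) * exp (- a) ^ n)"
      using a by (intro summable_mult summable_geometric) simp
    show "norm (exp (- a) ^ Suc n * cos (b * real (Suc n) * sqrt u)) \<le> exp (- a) * exp (- a) ^ n" for n
      by (simp add: abs_mult mult_left_le del: of_nat_Suc)
  qed
  have Re_exp_w: "Re (exp (- w u * of_nat (Suc n))) = exp (- a) ^ Suc n * cos (b * real (Suc n) * sqrt u)" for u n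
  proof -
    have "Re (- w u * of_nat (Suc n)) = - a * real (Suc n)" "Im (- w u * of_nat (Suc n)) = - (b * real (Suc n) * sqrt u)"
      by (simp_all add: w_def algebra_simps)
    moreover have "exp (- a * real (Suc n)) = exp (- a) ^ Suc n"
      by (simp only: exp_of_nat_mult[symmetric] mult.commute)
    ultimately show ?thesis by (simp only: Re_exp cos_minus)
  qed
  have g_complex: "Re (\<Sum>n. exp (- w u * of_nat (Suc n))) = g u" for u
  proof -
    have "norm (exp (- w u)) < 1" using a by (simp add: w_def)
    then have "summable (\<lambda>n. exp (- w u) * exp (- w u) ^ n)"
      by (intro summable_mult summable_geometric)
    moreover have "exp (- w u) * exp (- w u) ^ n = exp (- w u * of_nat (Suc n))" for n
      by (subst power_Suc[symmetric], subst exp_of_nat_mult[symmetric]) (simp only: mult.commute)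
    ultimately have "summable (\<lambda>n. exp (- w u * of_nat (Suc n)))" by simp
    from sums_Re[OF summable_sums[OF this]] show ?thesis
      unfolding Re_exp_w using g_sums sums_unique2 by blast
  qed
  have F_eq: "F k u = (-1) ^ k * Riemann_zeta (2 * real k + 2) * Re ((w u / of_real (2 * pi)) ^ (2 * k + 1))"
    if "u \<in> {0<..<1}" for k u
  proof -
    define z where "z = \<i> * of_real (x * sqrt u)"
    have wz: "w u / of_real (2 * pi) = of_real y + z"
      by (simp add: complex_eq_iff w_def z_def x_def y_def Re_divide_of_real Im_divide_of_real)
    have zp: "z ^ (2 * n) = of_real ((-1) ^ n * x ^ (2 * n) * u ^ n)" for n
    proof -
      have "z\<^sup>2 = of_real (- (x\<^sup>2 * u))"
        using that by (simp add: z_def power_mult_distrib flip: of_real_power)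
      then have "z ^ (2 * n) = of_real ((- (x\<^sup>2 * u)) ^ n)"
        by (simp only: power_mult of_real_power)
      also have "(- (x\<^sup>2 * u)) ^ n = (-1) ^ n * x ^ (2 * n) * u ^ n"
        by (subst power_minus) (simp add: power_mult power_mult_distrib)
      finally show ?thesis .
    qed
    have "2 * Re ((of_real y + z) ^ (2 * k + 1)) = Re ((of_real y + z) ^ (2 * k + 1) + (of_real y - z) ^ (2 * k + 1))"
    proof -
      have "of_real y - z = cnj (of_real y + z)" by (simp add: z_def)
      then show ?thesis by (simp only: complex_cnj_power[symmetric] plus_complex.sel cnj.sel)
    qed
    also have "\<dots> = 2 * (\<Sum>n\<le>k. real ((2 * k + 1) choose (2 * n)) * ((-1) ^ n * x ^ (2 * n) * u ^ n) * y ^ (2 * (k - n) + 1))"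
    proof -
      have "2 * (\<Sum>n\<le>k. of_nat ((2 * k + 1) choose (2 * n)) * z ^ (2 * n) * of_real y ^ (2 * (k - n) + 1)) =
          complex_of_real (2 * (\<Sum>n\<le>k. real ((2 * k + 1) choose (2 * n)) * ((-1) ^ n * x ^ (2 * n) * u ^ n) * y ^ (2 * (k - n) + 1)))"
        unfolding zp by simp
      then show ?thesis unfolding binomial_even_part by (simp only: Re_complex_of_real)
    qed
    finally have "Re ((of_real y + z) ^ (2 * k + 1)) = (\<Sum>n\<le>k. real ((2 * k + 1) choose (2 * n)) * ((-1) ^ n * x ^ (2 * n) * u ^ n) * y ^ (2 * (k - n) + 1))" by linarith
    then show ?thesis by (simp only: F_def wz)
  qed
  \<comment> \<open>Since sqrt u < 1, |w| \<le> a + b < 2 pi uniformly in u, which gives both the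
    expansion and its dominating series.\<close>
  have nw: "norm (w u / of_real (2 * pi)) \<le> x + y" "norm (w u) < 2 * pi" "0 < Re (w u)" if "u \<in> {0<..<1}" for u
  proof -
    have "norm (w u) \<le> \<bar>a\<bar> + \<bar>b * sqrt u\<bar>" unfolding w_def using cmod_le[of "Complex a (b * sqrt u)"] by simp
    also have "\<bar>b * sqrt u\<bar> \<le> b * 1" using that b0 by (simp add: abs_mult)
    finally have "norm (w u) \<le> a + b" using a by simp
    then show "norm (w u / of_real (2 * pi)) \<le> x + y" "norm (w u) < 2 * pi"
      using a by (simp_all add: norm_divide x_def y_def add_divide_distrib[symmetric] divide_right_mono add.commute)
    show "0 < Re (w u)" using a by (simp add: w_def)
  qed
  have "(\<lambda>k. integral\<^sup>L ?M (F k)) sums integral\<^sup>L ?M h"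
  proof (rule poisson_integral_sums[OF nu])
    show "F k \<in> borel_measurable borel" for k unfolding F_def[abs_def] by measurable
    show "h \<in> borel_measurable borel" unfolding h_def[abs_def] by measurable
    show "summable (\<lambda>k. Riemann_zeta 2 * (x + y) * ((x + y)\<^sup>2) ^ k)"
      using xy by (intro summable_mult summable_geometric) (simp add: power_less_one_iff abs_square_less_1)
    fix k :: nat and u :: real assume u: "u \<in> {0<..<1}"
    have "\<bar>F k u\<bar> = Riemann_zeta (2 * real k + 2) * \<bar>Re ((w u / of_real (2 * pi)) ^ (2 * k + 1))\<bar>"
      unfolding F_eq[OF u] using Riemann_zeta_even_bounds(1)[of k] by (simp add: abs_mult power_abs)
    also have "\<dots> \<le> Riemann_zeta 2 * (x + y) ^ (2 * k + 1)"
    proof (rule mult_mono[OF Riemann_zeta_even_bounds(2)])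
      have "\<bar>Re ((w u / of_real (2 * pi)) ^ (2 * k + 1))\<bar> \<le> norm (w u / of_real (2 * pi)) ^ (2 * k + 1)"
        unfolding norm_power[symmetric] by (rule abs_Re_le_cmod)
      also have "\<dots> \<le> (x + y) ^ (2 * k + 1)" by (intro power_mono nw[OF u] norm_ge_zero)
      finally show "\<bar>Re ((w u / of_real (2 * pi)) ^ (2 * k + 1))\<bar> \<le> (x + y) ^ (2 * k + 1)" .
    qed (use Riemann_zeta_even_bounds[of 0] in auto)
    also have "\<dots> = Riemann_zeta 2 * (x + y) * ((x + y)\<^sup>2) ^ k" by (simp add: power_mult)
    finally show "\<bar>F k u\<bar> \<le> Riemann_zeta 2 * (x + y) * ((x + y)\<^sup>2) ^ k" .
    have "(\<lambda>k. Re ((-1) ^ k * of_real (Riemann_zeta (2 * real k + 2)) * (w u / of_real (2 * pi)) ^ (2 * k + 1))) sums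
      Re (of_real pi * ((\<Sum>n. exp (- w u * of_nat (Suc n))) - 1 / w u + 1 / 2))"
      by (intro sums_Re exp_minus_geometric_expansion nw[OF u])
    moreover have "Re (of_real pi * ((\<Sum>n. exp (- w u * of_nat (Suc n))) - 1 / w u + 1 / 2)) = h u"
    proof -
      have "Re (1 / w u) = a / (a\<^sup>2 + b\<^sup>2 * u)"
        using u by (simp add: w_def Re_divide power_mult_distrib)
      then show ?thesis
        by (simp only: Re_complex_of_real Im_complex_of_real times_complex.sel plus_complex.sel minus_complex.sel
            g_complex h_def) simp
    qed
    moreover have "Re ((-1) ^ k * of_real (Riemann_zeta (2 * real k + 2)) * (w u / of_real (2 * pi)) ^ (2 * k + 1)) = F k u" for k
    proof -
      have "(-1) ^ k * of_real (Riemann_zeta (2 * real k + 2)) = complex_of_real ((-1) ^ k * Riemann_zeta (2 * real k + 2))"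
        by simp
      then show ?thesis unfolding F_eq[OF u] by (simp only: Re_complex_of_real Im_complex_of_real times_complex.sel)
    qed
    ultimately show "(\<lambda>k. F k u) sums h u" by simp
  qed
  moreover have "integral\<^sup>L ?M (F k) = (\<Sum>n\<le>k. f (k - n) n)" for k
  proof -
    have "integral\<^sup>L ?M (F k) = (-1) ^ k * Riemann_zeta (2 * real k + 2) *
      (\<Sum>n\<le>k. real ((2 * k + 1) choose (2 * n)) * ((-1) ^ n * x ^ (2 * n) * poisson_moment \<nu> n) * y ^ (2 * (k - n) + 1))"
      unfolding F_def using poisson_integral_power[OF nu] by simp
    also have "\<dots> = (\<Sum>n\<le>k. f (k - n) n)"
      unfolding sum_distrib_left
    proof (rule sum.cong[OF refl])
      fix n assume "n \<in> {..k}"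
      then have n: "k - n + n = k" by simp
      \<comment> \<open>The sign (-1)^n from the even powers of i b sqrt u turns (-1)^k into (-1)^(k
        - n), the sign of row k - n.\<close>
      have kn: "k + n = (k - n) + 2 * n" using n by linarith
      have "(-1) ^ (k + n) = ((-1) ^ (k - n) :: real)" unfolding kn power_add power_mult by simp
      then have "(-1) ^ k * (-1) ^ n = ((-1) ^ (k - n) :: real)" by (simp only: power_add)
      moreover have "p * Z * (B * (q * X * m) * Y) = (p * q) * (B * m * Z * X) * Y" for p q Z B X Y m :: real
        by (simp add: mult_ac)
      ultimately have s: "(-1) ^ k * Z * (B * ((-1) ^ n * X * m) * Y) = (-1) ^ (k - n) * (B * m * Z * X) * Y" for Z B X Y m :: real
        by (simp only:)
      show "(-1) ^ k * Riemann_zeta (2 * real k + 2) *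
        (real ((2 * k + 1) choose (2 * n)) * ((-1) ^ n * x ^ (2 * n) * poisson_moment \<nu> n) * y ^ (2 * (k - n) + 1)) = f (k - n) n"
        unfolding s f_def coeff_A_eq[OF nu] n ..
    qed
    finally show ?thesis .
  qed
  ultimately have "(\<lambda>k. \<Sum>n\<le>k. f (k - n) n) sums integral\<^sup>L ?M h" by simp
  moreover have "(\<lambda>k. \<Sum>n\<le>k. f (k - n) n) sums (\<Sum>k. \<Sum>n. f k n)"
    unfolding f_def by (rule double_series_diagonal[OF coeff_A_abs_summable[OF nu xy]])
  ultimately have "integral\<^sup>L ?M h = (\<Sum>k. \<Sum>n. f k n)" by (rule sums_unique2)
  then have int_h: "integral\<^sup>L ?M h = (\<Sum>k. (-1) ^ k * coeff_C b \<nu> k * (a / (2 * pi)) ^ (2 * k + 1))"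
    unfolding f_def x_def coeff_C_row[OF nu b] y_def .
  have g_bound: "\<bar>g u\<bar> \<le> exp (- a) * (1 / (1 - exp (- a)))" for u
  proof -
    have "(\<lambda>n. exp (- a) * exp (- a) ^ n) sums (exp (- a) * (1 / (1 - exp (- a))))"
      using a by (intro sums_mult geometric_sums) simp
    moreover have "norm (exp (- a) ^ Suc n * cos (b * real (Suc n) * sqrt u)) \<le> exp (- a) * exp (- a) ^ n" for n
      by (simp add: abs_mult mult_left_le del: of_nat_Suc)
    ultimately show ?thesis
      using norm_suminf_le[of "\<lambda>n. exp (- a) ^ Suc n * cos (b * real (Suc n) * sqrt u)" "\<lambda>n. exp (- a) * exp (- a) ^ n"]
      by (simp add: g_def sums_iff)
  qed
  have int_g: "integrable ?M g" by (rule poisson_integrable[OF nu g_meas g_bound])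
  have "has_bochner_integral ?M (\<lambda>u. pi * (g u - a / (a\<^sup>2 + b\<^sup>2 * u) + 1 / 2))
    (pi * (integral\<^sup>L ?M g - a / b * stieltjes \<nu> ((a / b)\<^sup>2) / b + 1 / 2 * rGamma (\<nu> + 1)))"
    using int_g poisson_integral_lorentz[OF a(1)] poisson_integral_const[OF nu, of "1 / 2"]
    by (intro has_bochner_integral_mult_right has_bochner_integral_add has_bochner_integral_diff)
       (simp_all only: has_bochner_integral_iff)
  then have "integral\<^sup>L ?M h = pi * (integral\<^sup>L ?M g - a / b * stieltjes \<nu> ((a / b)\<^sup>2) / b + 1 / 2 * rGamma (\<nu> + 1))"
    unfolding h_def by (rule has_bochner_integral_integral_eq)
  moreover have "integral\<^sup>L ?M g = Bessel_sum b \<nu> a"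
  proof -
    have "(\<lambda>n. \<integral>u. exp (- a) ^ Suc n * cos (b * real (Suc n) * sqrt u) \<partial>?M) sums integral\<^sup>L ?M g"
    proof (rule poisson_integral_sums[OF nu _ g_meas _ _ g_sums])
      show "summable (\<lambda>n. exp (- a) * exp (- a) ^ n)"
        using a by (intro summable_mult summable_geometric) simp
      show "\<bar>exp (- a) ^ Suc n * cos (b * real (Suc n) * sqrt u)\<bar> \<le> exp (- a) * exp (- a) ^ n" for n u
        by (simp add: abs_mult mult_left_le del: of_nat_Suc)
    qed measurable
    then show ?thesis
      unfolding Bessel_sum_def Bessel_term_eq integral_mult_right_zero by (simp only: sums_iff mult.commute)
  qed
  ultimately show ?thesis unfolding int_h by (simp add: field_simps)
qed

end

section \<open>Convergence on the boundary and asymptotics\<close>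

text \<open>Convergence leaves only a + b < 2 pi or a + b = 2 pi; in the second case the identity at
  r a, r < 1, is passed to the limit r -> 1.\<close>

lemma Bessel_sum_identity:
  fixes a b \<nu> :: real
  assumes a: "0 < a" "a \<le> b" and nu: "\<nu> > - 1 / 2" and b: "b < 2 * pi"
    and sum: "summable (\<lambda>k. (-1) ^ k * coeff_C b \<nu> k * (a / (2 * pi)) ^ (2 * k + 1))"
  shows "Bessel_sum b \<nu> a = Bessel_main_term b \<nu> a +
    1 / pi * (\<Sum>k. (-1) ^ k * coeff_C b \<nu> k * (a / (2 * pi)) ^ (2 * k + 1))"
proof -
  have b0: "0 < b" using a by simp
  have "a + b \<le> 2 * pi"
    by (rule coeff_C_series_summableD[OF nu b0 b a(1) sum])
  then consider "a + b < 2 * pi" | "a + b = 2 * pi" by linarith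
  then show ?thesis
  proof cases
    case 1
    then show ?thesis
      using Bessel_sum_expansion[OF nu b0 a(1)] Bessel_main_term_eq[OF nu b0 a] by simp
  next
    case 2
    define c where "c k = (-1) ^ k * coeff_C b \<nu> k * (a / (2 * pi)) ^ (2 * k + 1)" for k
    define T where "T s = s * stieltjes \<nu> (s\<^sup>2)" for s
    \<comment> \<open>The pole term is kept as an integral, because the differential equation
      already provides its continuity.\<close>
    define H where "H r = Bessel_sum b \<nu> (r * a) - (T (r * a / b) / b - rGamma (\<nu> + 1) / 2)" for r
    have "isCont T (1 * a / b)"
      unfolding T_def using a b0 by (intro DERIV_isCont[OF DERIV_poisson_kernel[OF nu]]) simp
    then have "isCont H 1"
      unfolding H_def[abs_def] using a b0
      by (intro isCont_diff isCont_divide continuous_const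
          isCont_o2[of 1 "\<lambda>r. r * a" "Bessel_sum b \<nu>"] isCont_Bessel_sum[OF nu b0]
          isCont_o2[of 1 "\<lambda>r. r * a / b" T] isCont_mult continuous_ident) auto
    then have "(H \<longlongrightarrow> H 1) (at_left 1)"
      unfolding isCont_def by (rule tendsto_within_subset) simp
    moreover have "(H \<longlongrightarrow> 1 / pi * (1 * suminf c)) (at_left 1)"
    proof (rule Lim_transform_eventually)
      \<comment> \<open>Scaling \<open>a\<close> by r in odd powers gives r times a power series in
        r^2, so Abel's theorem is applied at r^2.\<close>
      have sq: "filterlim (\<lambda>r::real. r\<^sup>2) (at_left 1) (at_left 1)"
      proof (rule tendsto_imp_filterlim_at_left)
        show "((\<lambda>r::real. r\<^sup>2) \<longlongrightarrow> 1) (at_left 1)" by (auto intro!: tendsto_eq_intros)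
        show "\<forall>\<^sub>F r::real in at_left 1. r\<^sup>2 < 1"
          using eventually_at_left_real[of 0 "1::real", OF zero_less_one]
          by (rule eventually_mono) (auto simp: power_less_one_iff abs_square_less_1)
      qed
      have "summable c" using sum by (simp only: c_def[abs_def])
      from filterlim_compose[OF Abel_limit[OF this] sq]
      show "((\<lambda>r. 1 / pi * (r * (\<Sum>k. c k * (r\<^sup>2) ^ k))) \<longlongrightarrow> 1 / pi * (1 * suminf c)) (at_left 1)"
        by (intro tendsto_mult tendsto_const tendsto_ident_at)
      show "\<forall>\<^sub>F r in at_left 1. 1 / pi * (r * (\<Sum>k. c k * (r\<^sup>2) ^ k)) = H r"
        using eventually_at_left_real[of 0 "1::real", OF zero_less_one]
      proof (rule eventually_mono)
        fix r :: real assume r: "r \<in> {0<..<1}"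
        then have ra: "0 < r * a" "r * a < a" using a by auto
        then have lt: "r * a + b < 2 * pi" using 2 by simp
        have c_r: "(-1) ^ k * coeff_C b \<nu> k * (r * a / (2 * pi)) ^ (2 * k + 1) = r * (c k * (r\<^sup>2) ^ k)" for k
          by (simp add: c_def power_mult[symmetric] power_mult_distrib power_divide mult_ac)
        have "summable (\<lambda>k. r * (c k * (r\<^sup>2) ^ k))"
          using coeff_C_series_summable(1)[OF nu b0 b ra(1) lt] unfolding c_r .
        then have s: "summable (\<lambda>k. c k * (r\<^sup>2) ^ k)"
          using r summable_mult[of "\<lambda>k. r * (c k * (r\<^sup>2) ^ k)" "1 / r"] by simp
        have "H r = 1 / pi * (\<Sum>k. r * (c k * (r\<^sup>2) ^ k))"
          using Bessel_sum_expansion[OF nu b0 ra(1) lt] unfolding c_r by (simp add: H_def T_def)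
        then show "1 / pi * (r * (\<Sum>k. c k * (r\<^sup>2) ^ k)) = H r"
          by (simp add: suminf_mult[OF s])
      qed
    qed
    ultimately have "H 1 = 1 / pi * (1 * suminf c)"
      by (rule tendsto_unique[rotated]) simp
    then show ?thesis
      using Bessel_main_term_eq[OF nu b0 a] by (simp add: H_def T_def c_def[abs_def])
  qed
qed

lemma Bessel_sum_asymptotic:
  fixes b \<nu> :: real
  assumes nu: "\<nu> > - 1 / 2" and b: "0 < b" "b < 2 * pi"
  shows "(\<lambda>t. Bessel_sum b \<nu> t - (Bessel_main_term b \<nu> t +
      1 / pi * (\<Sum>k<N. (-1) ^ k * coeff_C b \<nu> k * (t / (2 * pi)) ^ (2 * k + 1))))
    \<in> O[at_right 0](\<lambda>t. t ^ (2 * N + 1))"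
proof -
  \<comment> \<open>Small enough for the identity at every t < \<delta> (\<delta> \<le> b) and for
    absolute convergence at \<delta> itself (\<delta> + b < 2 pi); each tail term at t is at most (t
    / \<delta>)^(2 N + 1) times its unsigned value at \<delta>.\<close>
  define \<delta> where "\<delta> = min b ((2 * pi - b) / 2)"
  have \<delta>: "0 < \<delta>" "\<delta> \<le> b" "\<delta> + b < 2 * pi" using b by (auto simp: \<delta>_def min_def field_simps)
  define d where "d k = coeff_C b \<nu> k * (\<delta> / (2 * pi)) ^ (2 * k + 1)" for k
  have d: "summable d" unfolding d_def[abs_def] by (rule coeff_C_series_summable(2)[OF nu b \<delta>(1,3)])
  have d0: "d k \<ge> 0" for k using coeff_C_nonneg[OF nu b, of k] \<delta> by (simp add: d_def)
  define D where "D = (\<Sum>k. d (k + N))"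
  have dN: "summable (\<lambda>k. d (k + N))" using d by (rule summable_ignore_initial_segment)
  show ?thesis
  proof (rule bigoI)
    show "\<forall>\<^sub>F t in at_right 0. norm (Bessel_sum b \<nu> t - (Bessel_main_term b \<nu> t +
        1 / pi * (\<Sum>k<N. (-1) ^ k * coeff_C b \<nu> k * (t / (2 * pi)) ^ (2 * k + 1)))) \<le>
      (1 / pi * D / \<delta> ^ (2 * N + 1)) * norm (t ^ (2 * N + 1))"
      using eventually_at_right_real[OF \<delta>(1)]
    proof (rule eventually_mono)
      fix t assume t: "t \<in> {0<..<\<delta>}"
      define e where "e k = (-1) ^ k * coeff_C b \<nu> k * (t / (2 * pi)) ^ (2 * k + 1)" for k
      have e: "summable e"
        unfolding e_def[abs_def] using t \<delta> by (intro coeff_C_series_summable(1)[OF nu b]) auto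
      have "Bessel_sum b \<nu> t = Bessel_main_term b \<nu> t + 1 / pi * suminf e"
        unfolding e_def[abs_def] using t \<delta> e[unfolded e_def[abs_def]]
        by (intro Bessel_sum_identity[OF _ _ nu b(2)]) auto
      also have "suminf e = (\<Sum>k. e (k + N)) + (\<Sum>k<N. e k)"
        by (rule suminf_split_initial_segment[OF e])
      finally have eq: "Bessel_sum b \<nu> t - (Bessel_main_term b \<nu> t + 1 / pi * (\<Sum>k<N. e k)) = 1 / pi * (\<Sum>k. e (k + N))"
        by (simp add: algebra_simps)
      have "norm (\<Sum>k. e (k + N)) \<le> (\<Sum>k. (t / \<delta>) ^ (2 * N + 1) * d (k + N))"
      proof (rule norm_suminf_le)
        show "summable (\<lambda>k. (t / \<delta>) ^ (2 * N + 1) * d (k + N))" using dN by (rule summable_mult)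
        fix k
        have "norm (e (k + N)) = (t / \<delta>) ^ (2 * (k + N) + 1) * d (k + N)"
          using t \<delta> coeff_C_nonneg[OF nu b, of "k + N"]
          by (simp add: e_def d_def abs_mult power_abs power_divide del: power_Suc power_add)
        also have "\<dots> \<le> (t / \<delta>) ^ (2 * N + 1) * d (k + N)"
          using t \<delta> d0 by (intro mult_right_mono power_decreasing) auto
        finally show "norm (e (k + N)) \<le> (t / \<delta>) ^ (2 * N + 1) * d (k + N)" .
      qed
      also have "\<dots> = (t / \<delta>) ^ (2 * N + 1) * D" unfolding D_def by (rule suminf_mult[OF dN])
      finally have "1 / pi * norm (\<Sum>k. e (k + N)) \<le> 1 / pi * ((t / \<delta>) ^ (2 * N + 1) * D)"
        by (intro mult_left_mono) auto
      moreover have "1 / pi * ((t / \<delta>) ^ (2 * N + 1) * D) = (1 / pi * D / \<delta> ^ (2 * N + 1)) * norm (t ^ (2 * N + 1))"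
        using t by (simp add: power_divide abs_mult del: power_Suc power_add)
      ultimately show "norm (Bessel_sum b \<nu> t - (Bessel_main_term b \<nu> t +
          1 / pi * (\<Sum>k<N. (-1) ^ k * coeff_C b \<nu> k * (t / (2 * pi)) ^ (2 * k + 1)))) \<le>
        (1 / pi * D / \<delta> ^ (2 * N + 1)) * norm (t ^ (2 * N + 1))"
        unfolding e_def[symmetric] eq by (simp add: norm_mult)
    qed
  qed
qed

(* The series over k has radius of convergence 2 pi - b in a, so it may diverge although
   a <= b < 2 pi (e.g. a = b = 5). The identity is claimed for every admissible a at which that
   series converges, in particular for all small a, and as an asymptotic expansion for a -> 0+. *)
theorem theorem2:
  fixes a b \<nu> :: real
  assumes "a > 0" and "b > 0" and "\<nu> > - 1 / 2" and "a \<le> b" and "b < 2 * pi"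
  shows
    "summable (\<lambda>n. exp (- a * real (Suc n)) / (b * real (Suc n) / 2) powr \<nu> *
        Bessel_J \<nu> (b * real (Suc n))) \<and>
     (\<forall>k. summable (\<lambda>n. coeff_A \<nu> k n * (b / (2 * pi)) ^ (2 * n))) \<and>
     (a + b < 2 * pi \<longrightarrow>
        summable (\<lambda>k. (-1) ^ k * coeff_C b \<nu> k * (a / (2 * pi)) ^ (2 * k + 1))) \<and>
     (summable (\<lambda>k. (-1) ^ k * coeff_C b \<nu> k * (a / (2 * pi)) ^ (2 * k + 1)) \<longrightarrow>
        (\<Sum>n. exp (- a * real (Suc n)) / (b * real (Suc n) / 2) powr \<nu> *
           Bessel_J \<nu> (b * real (Suc n))) =
        sqrt pi / (b * Gamma (\<nu> + 1 / 2)) * (1 + a\<^sup>2 / b\<^sup>2) powr (\<nu> - 1 / 2)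
        - 1 / (2 * Gamma (1 + \<nu>))
        - 2 * a / b\<^sup>2 * rGamma \<nu> * hypergeo_2F1 1 (1 - \<nu>) (3 / 2) (- (a\<^sup>2 / b\<^sup>2))
        + 1 / pi * (\<Sum>k. (-1) ^ k * coeff_C b \<nu> k * (a / (2 * pi)) ^ (2 * k + 1))) \<and>
     (\<forall>N. (\<lambda>t. (\<Sum>n. exp (- t * real (Suc n)) / (b * real (Suc n) / 2) powr \<nu> *
              Bessel_J \<nu> (b * real (Suc n)))
          - (sqrt pi / (b * Gamma (\<nu> + 1 / 2)) * (1 + t\<^sup>2 / b\<^sup>2) powr (\<nu> - 1 / 2)
             - 1 / (2 * Gamma (1 + \<nu>))
             - 2 * t / b\<^sup>2 * rGamma \<nu> * hypergeo_2F1 1 (1 - \<nu>) (3 / 2) (- (t\<^sup>2 / b\<^sup>2))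
             + 1 / pi * (\<Sum>k<N. (-1) ^ k * coeff_C b \<nu> k * (t / (2 * pi)) ^ (2 * k + 1))))
        \<in> O[at_right 0](\<lambda>t. t ^ (2 * N + 1)))"
proof -
  have b: "0 < b" "b < 2 * pi" "b / (2 * pi) > 0" "b / (2 * pi) < 1" using assms by auto
  show ?thesis
    by (intro conjI allI impI,
        rule Bessel_summable[OF assms(3,2,1)],
        rule coeff_C_summable[OF assms(3) b(3,4)],
        erule coeff_C_series_summable(1)[OF assms(3) b(1,2) assms(1)],
        erule Bessel_sum_identity[OF assms(1,4,3,5), unfolded Bessel_sum_def Bessel_main_term_def],
        rule Bessel_sum_asymptotic[OF assms(3,2,5), unfolded Bessel_sum_def Bessel_main_term_def])
qed

end
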